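(* Consider the simultaneous block-fading binary symmetric wiretap channel with parameters $q_1\in[0,1]$, $q_2=1-q_1$, and crossover probabilities satisfying $p_1\le p_2\le 0.5$, $p_1^*\le p_2^*\le 0.5$, $p_1\le p_1^*$, $p_2\le p_2^*$. Its secrecy capacity with channel state information available only at the decoders is $$C^s_{\textrm{CSI-D}}= q_1[H(p_1^* )-H(p_1)]+q_2[H(p_2^* )-H(p_2)].$$
   Context: $H(p)=-p\log_2 p-(1-p)\log_2(1-p)$ is the binary entropy function, and BSC$(p)$ denotes the binary symmetric channel with crossover probability $p$. Simultaneous block-fading binary symmetric wiretap channel: the transmitter sends $NB$ binary symbols $X_{1:NB}$ organized in $B$ fading blocks of length $N$. Each block $k$ has a fading state $S_k\in\{1,2\}$, constant within the block, with $\Pr(S_k=1)=q_1$, $\Pr(S_k=2)=q_2$, states independent across blocks. Within block $k$, the legitimate receiver observes the output $Y$ of $N$ independent uses of BSC$(p_{S_k})$, and the eavesdropper observes the output $Z$ of $N$ independent uses of BSC$(p^*_{S_k})$ (same state for both). Let $\mathsf{S}=(S_1,\dots,S_B)$. A code consists of a (possibly randomized) encoder $X_{1:NB}=f(\mathsf{M})$ of a uniformly distributed message $\mathsf{M}$, which knows only the state distribution (not the realizations), and a decoder $\hat{\mathsf{M}}=g(Y_{1:NB},\mathsf{S})$ that knows the states; its rate is $\frac{1}{NB}\log_2$ of the message-set size. A rate $R$ is achievable if there are such codes of rate at least $R$ (asymptotically) with $N,B\to\infty$ such that $\Pr\{\mathsf{M}\ne\hat{\mathsf{M}}\}\to0$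 and $\frac{1}{NB}I(\mathsf{M};Z_{1:NB}\mid\mathsf{S})\to 0$. $C^s_{\textrm{CSI-D}}$ is the supremum of achievable rates. *)

theory Defs
  imports "HOL-Analysis.Analysis"
begin

text \<open>Binary entropy (base 2). Note log 2 0 = 0 in Isabelle, so H 0 = H 1 = 0.\<close>
definition bin_entropy :: "real \<Rightarrow> real" where
  "bin_entropy p = - p * log 2 p - (1 - p) * log 2 (1 - p)"

definition words :: "nat \<Rightarrow> bool list set" where
  "words n = {xs. length xs = n}"

definition states :: "nat \<Rightarrow> nat list set" where
  "states B = {s. length s = B \<and> set s \<subseteq> {1, 2}}"

definition state_prob :: "real \<Rightarrow> nat list \<Rightarrow> real" where
  "state_prob q1 s = (\<Prod>j<length s. if s ! j = 1 then q1 else 1 - q1)"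

text \<open>Block-fading BSC transition probability W(y|x,s): symbol i lies in block i div N,
  and in block k the channel is BSC(p (s!k)).\<close>
definition bf_bsc :: "(nat \<Rightarrow> real) \<Rightarrow> nat \<Rightarrow> nat list \<Rightarrow> bool list \<Rightarrow> bool list \<Rightarrow> real" where
  "bf_bsc p N s x y =
     (\<Prod>i<length x. if x ! i = y ! i then 1 - p (s ! (i div N)) else p (s ! (i div N)))"

text \<open>A (possibly randomized) encoder for messages {0..<M}: enc m x = Pr(X = x | M = m),
  a probability distribution on words of length N*B. It does not depend on the states.\<close>
definition valid_encoder :: "nat \<Rightarrow> nat \<Rightarrow> nat \<Rightarrow> (nat \<Rightarrow> bool list \<Rightarrow> real) \<Rightarrow> bool" where
  "valid_encoder N B M enc \<longleftrightarrow>
     (\<forall>m<M. (\<forall>x. 0 \<le> enc m x) \<and> (\<forall>x. x \<notin> words (N * B) \<longrightarrow> enc m x = 0)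
            \<and> (\<Sum>x\<in>words (N * B). enc m x) = 1)"

definition err_prob :: "real \<Rightarrow> (nat \<Rightarrow> real) \<Rightarrow> nat \<Rightarrow> nat \<Rightarrow> nat
     \<Rightarrow> (nat \<Rightarrow> bool list \<Rightarrow> real) \<Rightarrow> (bool list \<Rightarrow> nat list \<Rightarrow> nat) \<Rightarrow> real" where
  "err_prob q1 p N B M enc dec =
     (\<Sum>m<M. (1 / real M) *
        (\<Sum>s\<in>states B. state_prob q1 s *
          (\<Sum>x\<in>words (N * B). enc m x *
            (\<Sum>y\<in>words (N * B). bf_bsc p N s x y * (if dec y s \<noteq> m then 1 else 0)))))"

definition joint_mz :: "(nat \<Rightarrow> real) \<Rightarrow> nat \<Rightarrow> nat \<Rightarrow> nat
     \<Rightarrow> (nat \<Rightarrow> bool list \<Rightarrow> real) \<Rightarrow> nat list \<Rightarrow> nat \<Rightarrow> bool list \<Rightarrow> real" where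
  "joint_mz pe N B M enc s m z =
     (1 / real M) * (\<Sum>x\<in>words (N * B). enc m x * bf_bsc pe N s x z)"

definition leakage :: "real \<Rightarrow> (nat \<Rightarrow> real) \<Rightarrow> nat \<Rightarrow> nat \<Rightarrow> nat
     \<Rightarrow> (nat \<Rightarrow> bool list \<Rightarrow> real) \<Rightarrow> real" where
  "leakage q1 pe N B M enc =
     (\<Sum>s\<in>states B. state_prob q1 s *
       (\<Sum>m<M. \<Sum>z\<in>words (N * B).
          (let pmz = joint_mz pe N B M enc s m z;
               pz = (\<Sum>m'<M. joint_mz pe N B M enc s m' z)
           in if pmz = 0 then 0 else pmz * log 2 (pmz / ((1 / real M) * pz)))))"

definition achievable_csid :: "real \<Rightarrow> (nat \<Rightarrow> real) \<Rightarrow> (nat \<Rightarrow> real) \<Rightarrow> real \<Rightarrow> bool" where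
  "achievable_csid q1 p pe R \<longleftrightarrow>
     (\<exists>(N :: nat \<Rightarrow> nat) (B :: nat \<Rightarrow> nat) (M :: nat \<Rightarrow> nat)
        (enc :: nat \<Rightarrow> nat \<Rightarrow> bool list \<Rightarrow> real) (dec :: nat \<Rightarrow> bool list \<Rightarrow> nat list \<Rightarrow> nat).
        filterlim N at_top sequentially \<and> filterlim B at_top sequentially \<and>
        (\<forall>k. 0 < N k \<and> 0 < B k \<and> 1 \<le> M k \<and> valid_encoder (N k) (B k) (M k) (enc k)) \<and>
        (\<forall>\<epsilon>>0. eventually (\<lambda>k. log 2 (real (M k)) / real (N k * B k) \<ge> R - \<epsilon>) sequentially) \<and>
        ((\<lambda>k. err_prob q1 p (N k) (B k) (M k) (enc k) (dec k)) \<longlonglongrightarrow> 0) \<and>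
        ((\<lambda>k. leakage q1 pe (N k) (B k) (M k) (enc k) / real (N k * B k)) \<longlonglongrightarrow> 0))"

definition cap_csid :: "real \<Rightarrow> real \<Rightarrow> real \<Rightarrow> real \<Rightarrow> real \<Rightarrow> real" where
  "cap_csid q1 p1 p2 ps1 ps2 =
     Sup {R. achievable_csid q1 (\<lambda>j. if j = 1 then p1 else p2) (\<lambda>j. if j = 1 then ps1 else ps2) R}"

end

theory Submission
  imports Defs "HOL-Real_Asymp.Real_Asymp"
begin

text \<open>Since \<open>p j \<le> pe j \<le> 1/2\<close>, the eavesdropper's channel is the legitimate channel followed by a
  further binary symmetric channel. Conditionally on the states, data processing then bounds
  \<open>I(M;Y) - I(M;Z)\<close> by the sum of the entropy gaps over the symbols: output entropy can only grow under a
  doubly stochastic channel, and \<open>I(X;Z) \<le> I(X;Y)\<close> given \<open>M\<close>. With Fano's inequality this gives the converse.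

  For achievability take a uniformly random codebook \<open>c (m, l)\<close>, where \<open>l\<close> is chosen uniformly by the
  encoder. The legitimate receiver decodes \<open>(m, l)\<close> by typicality. The number of values of \<open>l\<close> is just
  small enough that an eavesdropper who is told \<open>m\<close> could decode \<open>l\<close>; Fano's inequality for this
  fictitious decoder shows that \<open>l\<close> uses up nearly the whole information \<open>I(X;Z)\<close>, so little is left
  about \<open>m\<close>. With blocks of length \<open>N = B\<close> and slack \<open>\<delta> = B powr (- 1/4)\<close>, Chebyshev's inequality makes
  all error terms vanish.\<close>

section \<open>Sums over words\<close>

text \<open>One encoder must serve every state sequence, so its rates are fixed at state averages.
  With \<open>n = N * B\<close> and mean entropies \<open>h\<close>, \<open>he\<close> of the two
  channels, \<open>log 2 L\<close> is about \<open>n * (1 - he)\<close> and \<open>log 2 M\<close>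
  about \<open>n * (he - h)\<close>; together they stay just below \<open>n * (1 - h)\<close>, which
  the receiver can decode with a threshold that ignores the state. For a particular state sequence
  the resulting leakage bound may be far from zero, but it is affine in the state-dependent
  quantities, and the leakage is itself a state average. Concentration can only come from the number
  of blocks: the state is constant within a block, so the state part of the variance has order
  \<open>N^2 * B\<close>, and against a deviation \<open>N * B * \<delta>\<close> Chebyshev's
  inequality leaves order \<open>1 / (B * \<delta>^2)\<close>, whatever \<open>N\<close> is.
  Information quantities are finite sums whose weights need not be normalised, so that the same
  inequalities apply to one message, to all messages and to the counting measure.\<close>

abbreviation lists_of :: "'a set \<Rightarrow> nat \<Rightarrow> 'a list set" where
  "lists_of A n \<equiv> {xs. set xs \<subseteq> A \<and> length xs = n}"

lemma words_eq_lists_of: "words n = lists_of UNIV n"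
  by (simp add: words_def)

lemma states_eq_lists_of: "states B = lists_of {1, 2} B"
  by (auto simp: states_def)

lemma finite_words [simp, intro]: "finite (words n)"
  using finite_lists_length_eq[of "UNIV :: bool set" n] by (simp add: words_def)

lemma finite_states [simp, intro]: "finite (states B)"
  by (simp add: states_eq_lists_of finite_lists_length_eq)

lemma card_words: "card (words n) = 2 ^ n"
  using card_lists_length_eq[of "UNIV :: bool set" n] by (simp add: words_eq_lists_of)

lemma sum_lists_of_Suc:
  assumes "finite A"
  shows "(\<Sum>xs\<in>lists_of A (Suc n). f xs) = (\<Sum>a\<in>A. \<Sum>xs\<in>lists_of A n. f (a # xs))"
proof -
  have "(\<Sum>xs\<in>lists_of A (Suc n). f xs) = (\<Sum>(xs, a)\<in>lists_of A n \<times> A. f (a # xs))"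
    unfolding lists_length_Suc_eq
    by (subst sum.reindex) (auto simp: inj_on_def intro!: sum.cong)
  also have "\<dots> = (\<Sum>xs\<in>lists_of A n. \<Sum>a\<in>A. f (a # xs))"
    by (simp add: sum.cartesian_product)
  also have "\<dots> = (\<Sum>a\<in>A. \<Sum>xs\<in>lists_of A n. f (a # xs))"
    by (rule sum.swap)
  finally show ?thesis .
qed

lemma lists_of_0: "lists_of A 0 = {[]}"
  by auto

lemma sum_lists_of_prod:
  fixes g :: "nat \<Rightarrow> 'a \<Rightarrow> 'b :: comm_semiring_1"
  assumes "finite A"
  shows "(\<Sum>xs\<in>lists_of A n. \<Prod>i<n. g i (xs ! i)) = (\<Prod>i<n. \<Sum>a\<in>A. g i a)"
proof (induction n arbitrary: g)
  case 0
  show ?case by (simp only: lists_of_0) simp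
next
  case (Suc n)
  have "(\<Sum>xs\<in>lists_of A (Suc n). \<Prod>i<Suc n. g i (xs ! i)) =
        (\<Sum>a\<in>A. \<Sum>xs\<in>lists_of A n. g 0 a * (\<Prod>i<n. g (Suc i) (xs ! i)))"
    using assms by (subst sum_lists_of_Suc) (simp_all only: prod.lessThan_Suc_shift nth_Cons_0 nth_Cons_Suc o_def)
  also have "\<dots> = (\<Sum>a\<in>A. g 0 a) * (\<Sum>xs\<in>lists_of A n. \<Prod>i<n. g (Suc i) (xs ! i))"
    by (simp add: sum_product)
  also have "\<dots> = (\<Sum>a\<in>A. g 0 a) * (\<Prod>i<n. \<Sum>a\<in>A. g (Suc i) a)"
    by (simp only: Suc.IH[of "\<lambda>i. g (Suc i)"])
  also have "\<dots> = (\<Prod>i<Suc n. \<Sum>a\<in>A. g i a)"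
    by (simp only: prod.lessThan_Suc_shift o_def)
  finally show ?case .
qed

lemma sum_lists_of_prod_one:
  fixes w :: "nat \<Rightarrow> 'a \<Rightarrow> 'b :: comm_semiring_1"
  assumes "finite A" and "\<And>i. i < n \<Longrightarrow> (\<Sum>a\<in>A. w i a) = 1"
  shows "(\<Sum>xs\<in>lists_of A n. \<Prod>i<n. w i (xs ! i)) = 1"
  using assms by (simp add: sum_lists_of_prod)

lemma sum_lists_of_prod_mean:
  fixes w f :: "nat \<Rightarrow> 'a \<Rightarrow> real"
  assumes "finite A" and "\<And>i. i < n \<Longrightarrow> (\<Sum>a\<in>A. w i a) = 1"
  shows "(\<Sum>xs\<in>lists_of A n. (\<Prod>i<n. w i (xs ! i)) * (\<Sum>i<n. f i (xs ! i))) =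
         (\<Sum>i<n. \<Sum>a\<in>A. w i a * f i a)"
  using assms(2)
proof (induction n arbitrary: w f)
  case 0
  show ?case by (simp only: lists_of_0) simp
next
  case (Suc n)
  let ?P = "\<lambda>xs. \<Prod>i<n. w (Suc i) (xs ! i)"
  let ?F = "\<lambda>xs. \<Sum>i<n. f (Suc i) (xs ! i)"
  have one: "(\<Sum>xs\<in>lists_of A n. ?P xs) = 1"
    using Suc.prems by (intro sum_lists_of_prod_one assms) auto
  have IH: "(\<Sum>xs\<in>lists_of A n. ?P xs * ?F xs) = (\<Sum>i<n. \<Sum>a\<in>A. w (Suc i) a * f (Suc i) a)"
    using Suc.prems by (intro Suc.IH) auto
  have "(\<Sum>xs\<in>lists_of A (Suc n). (\<Prod>i<Suc n. w i (xs ! i)) * (\<Sum>i<Suc n. f i (xs ! i))) =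
        (\<Sum>a\<in>A. \<Sum>xs\<in>lists_of A n. w 0 a * f 0 a * ?P xs + w 0 a * (?P xs * ?F xs))"
    using assms(1)
    by (subst sum_lists_of_Suc)
       (simp_all only: prod.lessThan_Suc_shift sum.lessThan_Suc_shift nth_Cons_0 nth_Cons_Suc o_def
         algebra_simps)
  also have "\<dots> = (\<Sum>a\<in>A. w 0 a * f 0 a * (\<Sum>xs\<in>lists_of A n. ?P xs)
                     + w 0 a * (\<Sum>xs\<in>lists_of A n. ?P xs * ?F xs))"
    by (simp only: sum.distrib sum_distrib_left)
  also have "\<dots> = (\<Sum>a\<in>A. w 0 a * f 0 a) + (\<Sum>i<n. \<Sum>a\<in>A. w (Suc i) a * f (Suc i) a)"
    using Suc.prems[of 0] by (simp add: one IH sum.distrib flip: sum_distrib_right)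
  also have "\<dots> = (\<Sum>i<Suc n. \<Sum>a\<in>A. w i a * f i a)"
    by (simp only: sum.lessThan_Suc_shift o_def)
  finally show ?case .
qed

text \<open>Independence and zero means remove all cross terms. The free offset \<open>u\<close>
  carries the induction: peeling off the first letter moves its value into \<open>u\<close>. Later
  \<open>u\<close> is the deviation caused by the states.\<close>

lemma sum_lists_of_prod_variance:
  fixes w f :: "nat \<Rightarrow> 'a \<Rightarrow> real"
  assumes "finite A" and "\<And>i. i < n \<Longrightarrow> (\<Sum>a\<in>A. w i a) = 1"
    and "\<And>i. i < n \<Longrightarrow> (\<Sum>a\<in>A. w i a * f i a) = 0"
  shows "(\<Sum>xs\<in>lists_of A n. (\<Prod>i<n. w i (xs ! i)) * (u + (\<Sum>i<n. f i (xs ! i)))\<^sup>2) =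
         u\<^sup>2 + (\<Sum>i<n. \<Sum>a\<in>A. w i a * (f i a)\<^sup>2)"
  using assms(2,3)
proof (induction n arbitrary: w f u)
  case 0
  show ?case by (simp only: lists_of_0) simp
next
  case (Suc n)
  let ?P = "\<lambda>xs. \<Prod>i<n. w (Suc i) (xs ! i)"
  let ?F = "\<lambda>xs. \<Sum>i<n. f (Suc i) (xs ! i)"
  let ?V = "\<Sum>i<n. \<Sum>a\<in>A. w (Suc i) a * (f (Suc i) a)\<^sup>2"
  have IH: "(\<Sum>xs\<in>lists_of A n. ?P xs * (v + ?F xs)\<^sup>2) = v\<^sup>2 + ?V" for v
    using Suc.prems by (intro Suc.IH) auto
  have "(\<Sum>xs\<in>lists_of A (Suc n). (\<Prod>i<Suc n. w i (xs ! i)) * (u + (\<Sum>i<Suc n. f i (xs ! i)))\<^sup>2) =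
        (\<Sum>a\<in>A. \<Sum>xs\<in>lists_of A n. w 0 a * (?P xs * ((u + f 0 a) + ?F xs)\<^sup>2))"
    using assms(1)
    by (subst sum_lists_of_Suc)
       (simp_all only: prod.lessThan_Suc_shift sum.lessThan_Suc_shift nth_Cons_0 nth_Cons_Suc o_def
         mult.assoc add.assoc)
  also have "\<dots> = (\<Sum>a\<in>A. w 0 a * ((u + f 0 a)\<^sup>2 + ?V))"
    by (simp only: IH flip: sum_distrib_left)
  also have "\<dots> = (\<Sum>a\<in>A. w 0 a * (u\<^sup>2 + ?V) + 2 * u * (w 0 a * f 0 a) + w 0 a * (f 0 a)\<^sup>2)"
    by (intro sum.cong refl) (simp only: power2_eq_square algebra_simps mult_2)
  also have "\<dots> = (u\<^sup>2 + ?V) + (\<Sum>a\<in>A. w 0 a * (f 0 a)\<^sup>2)"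
    using Suc.prems(1)[of 0] Suc.prems(2)[of 0]
    by (simp add: sum.distrib flip: sum_distrib_right sum_distrib_left)
  also have "\<dots> = u\<^sup>2 + (\<Sum>i<Suc n. \<Sum>a\<in>A. w i a * (f i a)\<^sup>2)"
    by (simp only: sum.lessThan_Suc_shift o_def)
  finally show ?case .
qed

section \<open>Inequalities for relative entropy\<close>

text \<open>This is \<open>ln t \<le> t - 1\<close> at \<open>t = v / u\<close>. Absolute continuity
  is essential: for \<open>v = 0 < u\<close> the conventions \<open>u / 0 = 0\<close> and
  \<open>log 2 0 = 0\<close> would turn an infinite divergence into 0.\<close>

lemma gibbs_pointwise:
  fixes u v :: real
  assumes "0 \<le> u" "0 \<le> v" "v = 0 \<Longrightarrow> u = 0"
  shows "(u - v) / ln 2 \<le> u * log 2 (u / v)"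
proof (cases "u = 0")
  case True
  then show ?thesis using assms by (simp add: divide_simps)
next
  case False
  then have pos: "0 < u" "0 < v" using assms by (auto simp: less_le)
  have "ln (v / u) \<le> v / u - 1"
    using pos by (intro ln_le_minus_one) simp
  then have "u * ln (v / u) \<le> v - u"
    using pos by (simp add: field_simps)
  moreover have "ln (v / u) = - ln (u / v)"
    using pos by (simp add: ln_div)
  ultimately have "u - v \<le> u * ln (u / v)" by simp
  then show ?thesis
    by (simp add: log_def divide_right_mono)
qed

text \<open>Only total masses are compared, so \<open>v\<close> may be a subprobability, as the
  guess in \<open>fano\<close> is.\<close>

lemma gibbs:
  fixes u v :: "'a \<Rightarrow> real"
  assumes "\<And>a. a \<in> A \<Longrightarrow> 0 \<le> u a" "\<And>a. a \<in> A \<Longrightarrow> 0 \<le> v a"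
    and "\<And>a. a \<in> A \<Longrightarrow> v a = 0 \<Longrightarrow> u a = 0" and "sum v A \<le> sum u A"
  shows "0 \<le> (\<Sum>a\<in>A. u a * log 2 (u a / v a))"
proof -
  have "0 \<le> (sum u A - sum v A) / ln 2" using assms(4) by simp
  also have "\<dots> = (\<Sum>a\<in>A. (u a - v a) / ln 2)"
    by (simp only: sum_subtractf flip: sum_divide_distrib)
  also have "\<dots> \<le> (\<Sum>a\<in>A. u a * log 2 (u a / v a))"
    by (intro sum_mono gibbs_pointwise assms)
  finally show ?thesis .
qed

lemma log_sum_inequality:
  fixes u v :: "'a \<Rightarrow> real"
  assumes "finite A" "\<And>a. a \<in> A \<Longrightarrow> 0 \<le> u a" "\<And>a. a \<in> A \<Longrightarrow> 0 \<le> v a"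
    and "\<And>a. a \<in> A \<Longrightarrow> v a = 0 \<Longrightarrow> u a = 0"
  shows "sum u A * log 2 (sum u A / sum v A) \<le> (\<Sum>a\<in>A. u a * log 2 (u a / v a))"
proof (cases "sum u A = 0")
  case True
  then have "\<forall>a\<in>A. u a = 0" using assms by (simp add: sum_nonneg_eq_0_iff)
  then show ?thesis by simp
next
  case False
  have U: "0 < sum u A" using False assms by (simp add: sum_nonneg order.not_eq_order_implies_strict)
  have V: "0 < sum v A"
    using False assms by (metis (no_types, lifting) less_eq_real_def sum_nonneg sum_nonneg_eq_0_iff sum.neutral)
  \<comment> \<open>Rescaling \<open>v\<close> by \<open>r\<close> gives it the total mass of
    \<open>u\<close>, which is what \<open>gibbs\<close> asks for; \<open>log 2 r\<close> then
    becomes the left-hand side.\<close>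
  define r where "r = sum u A / sum v A"
  have r: "0 < r" using U V by (simp add: r_def)
  have "0 \<le> (\<Sum>a\<in>A. u a * log 2 (u a / (r * v a)))"
  proof (rule gibbs)
    show "(\<Sum>a\<in>A. r * v a) \<le> sum u A"
      using V by (simp only: flip: sum_distrib_left) (simp add: r_def)
  qed (use assms r in auto)
  also have "\<dots> = (\<Sum>a\<in>A. u a * log 2 (u a / v a) - u a * log 2 r)"
  proof (rule sum.cong[OF refl])
    fix a assume a: "a \<in> A"
    show "u a * log 2 (u a / (r * v a)) = u a * log 2 (u a / v a) - u a * log 2 r"
    proof (cases "u a = 0")
      case False
      then have "0 < u a" "0 < v a" using assms(2-4)[OF a] by force+
      then show ?thesis using r by (simp add: log_divide log_mult algebra_simps)
    qed simp
  qed
  also have "\<dots> = (\<Sum>a\<in>A. u a * log 2 (u a / v a)) - sum u A * log 2 r"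
    by (simp add: sum_subtractf flip: sum_distrib_right)
  finally show ?thesis by (simp add: r_def)
qed

text \<open>The log-sum inequality at each output \<open>b\<close>, where \<open>V a b\<close>
  cancels inside the logarithm. Leaving \<open>f\<close> and \<open>g\<close> unnormalised allows
  the counting measure as \<open>g\<close>.\<close>

lemma data_processing:
  fixes f g :: "'a \<Rightarrow> real" and V :: "'a \<Rightarrow> 'b \<Rightarrow> real"
  assumes "finite A" "finite B" "\<And>a. a \<in> A \<Longrightarrow> 0 \<le> f a" "\<And>a. a \<in> A \<Longrightarrow> 0 \<le> g a"
    and "\<And>a. a \<in> A \<Longrightarrow> g a = 0 \<Longrightarrow> f a = 0"
    and "\<And>a b. a \<in> A \<Longrightarrow> b \<in> B \<Longrightarrow> 0 \<le> V a b" and "\<And>a. a \<in> A \<Longrightarrow> (\<Sum>b\<in>B. V a b) = 1"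
  shows "(\<Sum>b\<in>B. (\<Sum>a\<in>A. f a * V a b) * log 2 ((\<Sum>a\<in>A. f a * V a b) / (\<Sum>a\<in>A. g a * V a b)))
       \<le> (\<Sum>a\<in>A. f a * log 2 (f a / g a))"
proof -
  have "(\<Sum>b\<in>B. (\<Sum>a\<in>A. f a * V a b) * log 2 ((\<Sum>a\<in>A. f a * V a b) / (\<Sum>a\<in>A. g a * V a b)))
      \<le> (\<Sum>b\<in>B. \<Sum>a\<in>A. (f a * V a b) * log 2 ((f a * V a b) / (g a * V a b)))"
    using assms by (intro sum_mono log_sum_inequality) auto
  also have "\<dots> = (\<Sum>b\<in>B. \<Sum>a\<in>A. V a b * (f a * log 2 (f a / g a)))"
    by (intro sum.cong refl) simp
  also have "\<dots> = (\<Sum>a\<in>A. (\<Sum>b\<in>B. V a b) * (f a * log 2 (f a / g a)))"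
    by (subst sum.swap) (simp add: sum_distrib_right)
  also have "\<dots> = (\<Sum>a\<in>A. f a * log 2 (f a / g a))"
    using assms(7) by simp
  finally show ?thesis .
qed

text \<open>Minus the sum of \<open>xlog\<close> over a distribution is its entropy; letters of
  probability 0 contribute 0.\<close>

definition xlog :: "real \<Rightarrow> real" where
  "xlog x = x * log 2 x"

section \<open>Chain rule, Fano's inequality, data processing and mutual information\<close>

lemma mult_log_div: "0 \<le> x \<Longrightarrow> (y = 0 \<Longrightarrow> x = 0) \<Longrightarrow> 0 \<le> y \<Longrightarrow> x * log 2 (x / y) = xlog x - x * log 2 y"
  by (cases "x = 0") (auto simp: xlog_def log_divide algebra_simps)

text \<open>The chain rule: both sides are minus the entropy of \<open>i\<close> given
  \<open>y\<close>.\<close>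

lemma sum_mult_log_marginal:
  fixes P :: "'a \<Rightarrow> 'b \<Rightarrow> real"
  assumes "finite I" "\<And>i y. i \<in> I \<Longrightarrow> y \<in> Y \<Longrightarrow> 0 \<le> P i y"
  shows "(\<Sum>i\<in>I. \<Sum>y\<in>Y. P i y * log 2 (P i y / (\<Sum>j\<in>I. P j y))) =
         (\<Sum>i\<in>I. \<Sum>y\<in>Y. xlog (P i y)) - (\<Sum>y\<in>Y. xlog (\<Sum>j\<in>I. P j y))"
proof -
  have "(\<Sum>i\<in>I. \<Sum>y\<in>Y. P i y * log 2 (P i y / (\<Sum>j\<in>I. P j y))) =
        (\<Sum>i\<in>I. \<Sum>y\<in>Y. xlog (P i y) - P i y * log 2 (\<Sum>j\<in>I. P j y))"
    using assms by (intro sum.cong refl mult_log_div) (auto simp: sum_nonneg_eq_0_iff intro: sum_nonneg)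
  also have "\<dots> = (\<Sum>i\<in>I. \<Sum>y\<in>Y. xlog (P i y)) - (\<Sum>i\<in>I. \<Sum>y\<in>Y. P i y * log 2 (\<Sum>j\<in>I. P j y))"
    by (simp add: sum_subtractf)
  also have "(\<Sum>i\<in>I. \<Sum>y\<in>Y. P i y * log 2 (\<Sum>j\<in>I. P j y)) = (\<Sum>y\<in>Y. xlog (\<Sum>j\<in>I. P j y))"
    by (subst sum.swap) (simp add: xlog_def sum_distrib_right)
  finally show ?thesis .
qed

text \<open>Gibbs' inequality against the guess that gives weight 1/2 to the decoded index and
  spreads the other half evenly.\<close>
lemma fano:
  fixes P :: "'a \<Rightarrow> 'b \<Rightarrow> real"
  assumes fin: "finite I" "finite Y" and ne: "I \<noteq> {}" and P: "\<And>i y. i \<in> I \<Longrightarrow> y \<in> Y \<Longrightarrow> 0 \<le> P i y"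
  shows "(\<Sum>y\<in>Y. xlog (\<Sum>i\<in>I. P i y)) - (\<Sum>i\<in>I. \<Sum>y\<in>Y. xlog (P i y)) \<le>
         (\<Sum>i\<in>I. \<Sum>y\<in>Y. P i y) + log 2 (card I) * (\<Sum>i\<in>I. \<Sum>y\<in>Y. P i y * of_bool (d y \<noteq> i))"
proof -
  define t where "t i y = (if i = d y then 1 / 2 else 1 / (2 * real (card I)))" for i y
  define Q where "Q y = (\<Sum>i\<in>I. P i y)" for y
  have card: "0 < real (card I)" using fin ne by (simp add: card_gt_0_iff)
  have t: "0 < t i y" for i y using card by (simp add: t_def)
  \<comment> \<open>At most 1 rather than equal to 1: the decoded index gets no share of the other
    half, and \<open>d y\<close> may lie outside \<open>I\<close>.\<close>
  have t1: "(\<Sum>i\<in>I. t i y) \<le> 1" for y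
  proof -
    have "(\<Sum>i\<in>I. t i y) \<le> (\<Sum>i\<in>I. of_bool (i = d y) / 2 + 1 / (2 * real (card I)))"
      by (intro sum_mono) (auto simp: t_def)
    also have "\<dots> = (\<Sum>i\<in>I. of_bool (i = d y)) / 2 + 1 / 2"
      using card by (simp add: sum.distrib sum_divide_distrib)
    also have "(\<Sum>i\<in>I. of_bool (i = d y)) = (of_bool (d y \<in> I) :: real)"
      using fin by (simp add: of_bool_def sum.delta)
    finally show ?thesis by (simp split: if_splits add: of_bool_def)
  qed
  have Q: "0 \<le> Q y" "i \<in> I \<Longrightarrow> Q y = 0 \<Longrightarrow> P i y = 0" if "y \<in> Y" for i y
    using P fin that by (auto simp: Q_def sum_nonneg sum_nonneg_eq_0_iff)
  have "0 \<le> (\<Sum>(i, y)\<in>I \<times> Y. P i y * log 2 (P i y / (Q y * t i y)))"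
    unfolding split_def
  proof (rule gibbs)
    have "(\<Sum>z\<in>I \<times> Y. Q (snd z) * t (fst z) (snd z)) = (\<Sum>i\<in>I. \<Sum>y\<in>Y. Q y * t i y)"
      by (simp add: sum.cartesian_product split_def)
    also have "\<dots> = (\<Sum>y\<in>Y. Q y * (\<Sum>i\<in>I. t i y))"
      by (subst sum.swap) (simp add: sum_distrib_left)
    also have "\<dots> \<le> (\<Sum>y\<in>Y. Q y)"
      using Q t1 by (intro sum_mono) (simp add: mult_left_le)
    also have "\<dots> = (\<Sum>z\<in>I \<times> Y. P (fst z) (snd z))"
      unfolding Q_def by (subst sum.swap) (simp add: sum.cartesian_product split_def)
    finally show "(\<Sum>z\<in>I \<times> Y. Q (snd z) * t (fst z) (snd z)) \<le> (\<Sum>z\<in>I \<times> Y. P (fst z) (snd z))" .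
  qed (use P Q t less_imp_le[OF t] in \<open>auto simp: less_imp_neq[OF t, symmetric]\<close>)
  also have "\<dots> = (\<Sum>i\<in>I. \<Sum>y\<in>Y. P i y * log 2 (P i y / (Q y * t i y)))"
    by (simp add: sum.cartesian_product)
  also have "\<dots> = (\<Sum>i\<in>I. \<Sum>y\<in>Y. P i y * log 2 (P i y / Q y) +
                     (P i y + log 2 (card I) * (P i y * of_bool (d y \<noteq> i))))"
  proof (intro sum.cong refl)
    fix i y assume iy: "i \<in> I" "y \<in> Y"
    show "P i y * log 2 (P i y / (Q y * t i y)) =
          P i y * log 2 (P i y / Q y) + (P i y + log 2 (card I) * (P i y * of_bool (d y \<noteq> i)))"
    proof (cases "P i y = 0")
      case False
      then have "0 < P i y" "0 < Q y" using P Q iy by (metis less_eq_real_def)+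
      then have "P i y * log 2 (P i y / (Q y * t i y)) = P i y * (log 2 (P i y / Q y) - log 2 (t i y))"
        using t[of i y] by (simp add: log_divide log_mult)
      moreover have "log 2 (t i y) = - 1 - log 2 (card I) * of_bool (d y \<noteq> i)"
        using card by (auto simp: t_def log_divide log_mult)
      ultimately show ?thesis
        by (simp only: right_diff_distrib distrib_left) (simp add: algebra_simps)
    qed simp
  qed
  also have "\<dots> = (\<Sum>i\<in>I. \<Sum>y\<in>Y. P i y * log 2 (P i y / Q y)) + ((\<Sum>i\<in>I. \<Sum>y\<in>Y. P i y) +
                   log 2 (card I) * (\<Sum>i\<in>I. \<Sum>y\<in>Y. P i y * of_bool (d y \<noteq> i)))"
    by (simp add: sum.distrib sum_distrib_left)
  finally show ?thesis
    using sum_mult_log_marginal[of I Y P] P fin by (simp add: Q_def)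
qed

text \<open>Data processing relative to the counting measure, which the column sums make invariant
  under \<open>V\<close>; hence entropy cannot decrease.\<close>

lemma xlog_sum_doubly_stochastic:
  fixes V :: "'a \<Rightarrow> 'b \<Rightarrow> real"
  assumes "finite A" "finite B" "\<And>a. a \<in> A \<Longrightarrow> 0 \<le> f a"
    and "\<And>a b. a \<in> A \<Longrightarrow> b \<in> B \<Longrightarrow> 0 \<le> V a b"
    and "\<And>a. a \<in> A \<Longrightarrow> (\<Sum>b\<in>B. V a b) = 1" and "\<And>b. b \<in> B \<Longrightarrow> (\<Sum>a\<in>A. V a b) = 1"
  shows "(\<Sum>b\<in>B. xlog (\<Sum>a\<in>A. f a * V a b)) \<le> (\<Sum>a\<in>A. xlog (f a))"
  using data_processing[of A B f "\<lambda>_. 1" V] assms by (simp add: xlog_def)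

text \<open>For normalised \<open>r\<close>, mutual information as output entropy minus noise
  entropy. Inputs of weight zero are treated apart, since the output marginal may vanish where their
  row of \<open>W\<close> does not.\<close>

lemma sum_channel_log_ratio:
  fixes W :: "'a \<Rightarrow> 'b \<Rightarrow> real"
  assumes "finite A" "\<And>a. a \<in> A \<Longrightarrow> 0 \<le> r a" "\<And>a b. a \<in> A \<Longrightarrow> b \<in> B \<Longrightarrow> 0 \<le> W a b"
  shows "(\<Sum>a\<in>A. r a * (\<Sum>b\<in>B. W a b * log 2 (W a b / (\<Sum>a'\<in>A. r a' * W a' b)))) =
         (\<Sum>a\<in>A. r a * (\<Sum>b\<in>B. xlog (W a b))) - (\<Sum>b\<in>B. xlog (\<Sum>a\<in>A. r a * W a b))"
proof -
  define Q where "Q b = (\<Sum>a\<in>A. r a * W a b)" for b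
  have "r a * (\<Sum>b\<in>B. W a b * log 2 (W a b / Q b)) =
        r a * (\<Sum>b\<in>B. xlog (W a b)) - (\<Sum>b\<in>B. r a * W a b * log 2 (Q b))" if a: "a \<in> A" for a
  proof (cases "r a = 0")
    case False
    have "W a b * log 2 (W a b / Q b) = xlog (W a b) - W a b * log 2 (Q b)" if b: "b \<in> B" for b
    proof (rule mult_log_div)
      show "Q b = 0 \<Longrightarrow> W a b = 0"
        using assms a b False by (auto simp: Q_def sum_nonneg_eq_0_iff)
    qed (use assms a b in \<open>auto simp: Q_def intro!: sum_nonneg\<close>)
    then show ?thesis
      by (simp add: sum_subtractf right_diff_distrib sum_distrib_left mult.assoc)
  qed simp
  then have "(\<Sum>a\<in>A. r a * (\<Sum>b\<in>B. W a b * log 2 (W a b / Q b))) =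
        (\<Sum>a\<in>A. r a * (\<Sum>b\<in>B. xlog (W a b))) - (\<Sum>a\<in>A. \<Sum>b\<in>B. r a * W a b * log 2 (Q b))"
    by (simp add: sum_subtractf)
  also have "(\<Sum>a\<in>A. \<Sum>b\<in>B. r a * W a b * log 2 (Q b)) = (\<Sum>b\<in>B. xlog (Q b))"
    by (subst sum.swap) (simp add: xlog_def Q_def sum_distrib_right)
  finally show ?thesis by (simp add: Q_def)
qed

text \<open>For each input the divergence of its output law from the output marginal shrinks under
  \<open>V\<close>; averaging gives I(a;c) \<le> I(a;b). The weight \<open>r\<close> need not sum to
  1 because it will be the part of the input law that belongs to one message.\<close>

lemma channel_data_processing:
  fixes W :: "'a \<Rightarrow> 'b \<Rightarrow> real" and V :: "'b \<Rightarrow> 'c \<Rightarrow> real"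
  assumes fin: "finite A" "finite B" "finite C"
    and r: "\<And>a. a \<in> A \<Longrightarrow> 0 \<le> r a" and W: "\<And>a b. a \<in> A \<Longrightarrow> b \<in> B \<Longrightarrow> 0 \<le> W a b"
    and V: "\<And>b c. b \<in> B \<Longrightarrow> c \<in> C \<Longrightarrow> 0 \<le> V b c" "\<And>b. b \<in> B \<Longrightarrow> (\<Sum>c\<in>C. V b c) = 1"
    and U: "\<And>a c. a \<in> A \<Longrightarrow> c \<in> C \<Longrightarrow> U a c = (\<Sum>b\<in>B. W a b * V b c)"
  shows "(\<Sum>a\<in>A. r a * (\<Sum>c\<in>C. xlog (U a c))) - (\<Sum>c\<in>C. xlog (\<Sum>a\<in>A. r a * U a c)) \<le>
         (\<Sum>a\<in>A. r a * (\<Sum>b\<in>B. xlog (W a b))) - (\<Sum>b\<in>B. xlog (\<Sum>a\<in>A. r a * W a b))"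
proof -
  define Q where "Q b = (\<Sum>a\<in>A. r a * W a b)" for b
  have Q: "0 \<le> Q b" if "b \<in> B" for b
    using that r W by (auto simp: Q_def intro!: sum_nonneg)
  have QV: "(\<Sum>a\<in>A. r a * U a c) = (\<Sum>b\<in>B. Q b * V b c)" if "c \<in> C" for c
    using that unfolding Q_def sum_distrib_right
    by (subst sum.swap) (simp add: U sum_distrib_left mult.assoc)
  have U_nonneg: "0 \<le> U a c" if "a \<in> A" "c \<in> C" for a c
    using that W V by (auto simp: U intro!: sum_nonneg)
  have step: "r a * (\<Sum>c\<in>C. U a c * log 2 (U a c / (\<Sum>a\<in>A. r a * U a c))) \<le>
              r a * (\<Sum>b\<in>B. W a b * log 2 (W a b / Q b))" if a: "a \<in> A" for a
  proof (cases "r a = 0")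
    case False
    have "(\<Sum>c\<in>C. U a c * log 2 (U a c / (\<Sum>a\<in>A. r a * U a c))) =
          (\<Sum>c\<in>C. (\<Sum>b\<in>B. W a b * V b c) * log 2 ((\<Sum>b\<in>B. W a b * V b c) / (\<Sum>b\<in>B. Q b * V b c)))"
      by (intro sum.cong refl) (simp only: QV U[OF a])
    also have "\<dots> \<le> (\<Sum>b\<in>B. W a b * log 2 (W a b / Q b))"
    proof (rule data_processing)
      fix b assume b: "b \<in> B" "Q b = 0"
      then show "W a b = 0"
        using fin r W a False by (auto simp: Q_def sum_nonneg_eq_0_iff)
    qed (use fin W V Q a in auto)
    finally show ?thesis using r[OF a] by (rule mult_left_mono)
  qed simp
  have "(\<Sum>a\<in>A. r a * (\<Sum>c\<in>C. U a c * log 2 (U a c / (\<Sum>a\<in>A. r a * U a c)))) \<le>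
        (\<Sum>a\<in>A. r a * (\<Sum>b\<in>B. W a b * log 2 (W a b / Q b)))"
    by (intro sum_mono step)
  then show ?thesis
    using sum_channel_log_ratio[of A r C U] sum_channel_log_ratio[of A r B W]
      fin r W U_nonneg by (simp add: Q_def)
qed

text \<open>H(M) + H(Y) - H(M,Y), with H(M) = \<open>log 2 M\<close> because the message is
  uniform.\<close>

definition mutual_info :: "nat \<Rightarrow> 'b set \<Rightarrow> (nat \<Rightarrow> 'b \<Rightarrow> real) \<Rightarrow> real" where
  "mutual_info M Y P =
     log 2 M + (\<Sum>m<M. \<Sum>y\<in>Y. xlog (P m y)) - (\<Sum>y\<in>Y. xlog (\<Sum>m<M. P m y))"

lemma mutual_info_altdef:
  assumes "0 < M" "\<And>m y. m < M \<Longrightarrow> y \<in> Y \<Longrightarrow> 0 \<le> P m y" "(\<Sum>m<M. \<Sum>y\<in>Y. P m y) = 1"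
  shows "(\<Sum>m<M. \<Sum>y\<in>Y. P m y * log 2 (P m y / ((1 / real M) * (\<Sum>m'<M. P m' y)))) = mutual_info M Y P"
proof -
  have "P m y * log 2 (P m y / ((1 / real M) * (\<Sum>m'<M. P m' y))) =
        P m y * log 2 M + P m y * log 2 (P m y / (\<Sum>m'<M. P m' y))" if "m < M" "y \<in> Y" for m y
  proof (cases "P m y = 0")
    case False
    then have "0 < P m y" using assms(2)[OF that] by simp
    moreover have "0 < (\<Sum>m'<M. P m' y)"
      using that assms(2) calculation by (intro sum_pos2[of _ m]) auto
    ultimately show ?thesis
      using assms(1) by (simp add: log_divide log_mult algebra_simps)
  qed simp
  then have "(\<Sum>m<M. \<Sum>y\<in>Y. P m y * log 2 (P m y / ((1 / real M) * (\<Sum>m'<M. P m' y)))) =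
      (\<Sum>m<M. \<Sum>y\<in>Y. P m y) * log 2 M + (\<Sum>m<M. \<Sum>y\<in>Y. P m y * log 2 (P m y / (\<Sum>m'<M. P m' y)))"
    by (simp add: sum.distrib sum_distrib_right)
  then show ?thesis
    using assms(2,3) sum_mult_log_marginal[of "{..<M}" Y P] by (simp add: mutual_info_def)
qed

section \<open>The binary symmetric channel\<close>

definition bsc :: "real \<Rightarrow> bool \<Rightarrow> bool \<Rightarrow> real" where
  "bsc q a b = (if a = b then 1 - q else q)"

lemma bsc_nonneg: "0 \<le> q \<Longrightarrow> q \<le> 1 \<Longrightarrow> 0 \<le> bsc q a b"
  by (simp add: bsc_def)

lemma bsc_commute: "bsc q a b = bsc q b a"
  by (auto simp: bsc_def)

lemma sum_bsc [simp]: "(\<Sum>b\<in>UNIV. bsc q a b) = 1" "(\<Sum>a\<in>UNIV. bsc q a b) = 1"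
  by (cases a; cases b; simp add: bsc_def UNIV_bool)+

lemma bsc_compose: "(\<Sum>b\<in>UNIV. bsc q a b * bsc t b c) = bsc (q * (1 - t) + (1 - q) * t) a c"
  by (cases a; cases c; simp add: bsc_def UNIV_bool algebra_simps)

lemma sum_xlog_bsc: "(\<Sum>b\<in>UNIV. xlog (bsc q a b)) = - bin_entropy q"
  by (cases a; simp add: bsc_def UNIV_bool xlog_def bin_entropy_def)

text \<open>The crossover probability \<open>t\<close> solving
  \<open>q * (1 - t) + (1 - q) * t = q'\<close>. For \<open>q = 1/2\<close> the quotient defaults to
  0, which is right, since then \<open>q' = 1/2\<close> too.\<close>

definition degradation :: "real \<Rightarrow> real \<Rightarrow> real" where
  "degradation q q' = (q' - q) / (1 - 2 * q)"

lemma degradation: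
  assumes "0 \<le> q" "q \<le> q'" "q' \<le> 1/2"
  shows "0 \<le> degradation q q'" "degradation q q' \<le> 1"
    and "q * (1 - degradation q q') + (1 - q) * degradation q q' = q'"
proof -
  show "0 \<le> degradation q q'" using assms by (simp add: degradation_def)
  show "degradation q q' \<le> 1"
    using assms by (cases "q = 1/2") (auto simp: degradation_def divide_simps)
  have "(1 - 2 * q) * degradation q q' = q' - q"
    using assms by (cases "q = 1/2") (auto simp: degradation_def)
  then show "q * (1 - degradation q q') + (1 - q) * degradation q q' = q'"
    by (simp add: algebra_simps)
qed

text \<open>BSC(\<open>q'\<close>) is BSC(\<open>q\<close>) followed by a doubly stochastic channel,
  and such a channel can only raise the output entropy.\<close>

lemma bin_entropy_mono:
  assumes "0 \<le> q" "q \<le> q'" "q' \<le> 1/2"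
  shows "bin_entropy q \<le> bin_entropy q'"
proof -
  have "(\<Sum>b\<in>UNIV. xlog (\<Sum>a\<in>UNIV. bsc q True a * bsc (degradation q q') a b)) \<le> (\<Sum>a\<in>UNIV. xlog (bsc q True a))"
    using degradation[OF assms] assms
    by (intro xlog_sum_doubly_stochastic) (auto intro!: bsc_nonneg)
  then show ?thesis
    by (simp add: bsc_compose degradation[OF assms] sum_xlog_bsc)
qed

lemma bin_entropy_bounds:
  assumes "0 \<le> q" "q \<le> 1/2"
  shows "0 \<le> bin_entropy q" "bin_entropy q \<le> 1"
  using bin_entropy_mono[of 0 q] bin_entropy_mono[of q "1/2"] assms
  by (simp_all add: bin_entropy_def log_divide)

section \<open>The block-fading channel as a product of binary symmetric channels\<close>

lemma bf_bsc_altdef: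
  assumes "x \<in> words n"
  shows "bf_bsc p N s x y = (\<Prod>i<n. bsc (p (s ! (i div N))) (x ! i) (y ! i))"
  using assms by (simp add: words_def bf_bsc_def bsc_def)

lemma bf_bsc_nonneg: "(\<And>j. 0 \<le> p j \<and> p j \<le> 1) \<Longrightarrow> 0 \<le> bf_bsc p N s x y"
  by (auto simp: bf_bsc_def intro!: prod_nonneg)

lemma sum_bf_bsc:
  assumes "x \<in> words n"
  shows "(\<Sum>y\<in>words n. bf_bsc p N s x y) = 1"
  unfolding bf_bsc_altdef[OF assms] words_eq_lists_of by (intro sum_lists_of_prod_one) simp_all

lemma bf_bsc_commute: "x \<in> words n \<Longrightarrow> y \<in> words n \<Longrightarrow> bf_bsc p N s x y = bf_bsc p N s y x"
  by (simp add: bf_bsc_altdef bsc_commute)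

lemma sum_bf_bsc': "y \<in> words n \<Longrightarrow> (\<Sum>x\<in>words n. bf_bsc p N s x y) = 1"
  by (subst sum_bf_bsc[symmetric, of y n p N s]) (auto intro!: sum.cong bf_bsc_commute)

lemma bf_bsc_compose:
  assumes "x \<in> words n"
  shows "(\<Sum>y\<in>words n. bf_bsc p N s x y * bf_bsc t N s y z) =
         bf_bsc (\<lambda>j. p j * (1 - t j) + (1 - p j) * t j) N s x z"
proof -
  have "(\<Sum>y\<in>words n. bf_bsc p N s x y * bf_bsc t N s y z) =
        (\<Sum>y\<in>words n. \<Prod>i<n. bsc (p (s ! (i div N))) (x ! i) (y ! i) * bsc (t (s ! (i div N))) (y ! i) (z ! i))"
    using assms by (simp add: bf_bsc_altdef prod.distrib)
  also have "\<dots> = (\<Prod>i<n. \<Sum>b\<in>UNIV. bsc (p (s ! (i div N))) (x ! i) b * bsc (t (s ! (i div N))) b (z ! i))"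
    unfolding words_eq_lists_of
    by (rule sum_lists_of_prod[of UNIV "\<lambda>i b. bsc (p (s ! (i div N))) (x ! i) b * bsc (t (s ! (i div N))) b (z ! i)"]) simp
  finally show ?thesis
    using assms by (simp add: bsc_compose bf_bsc_altdef)
qed

lemma log_prod:
  fixes f :: "'a \<Rightarrow> real"
  assumes "finite I" "\<And>i. i \<in> I \<Longrightarrow> 0 < f i"
  shows "log 2 (\<Prod>i\<in>I. f i) = (\<Sum>i\<in>I. log 2 (f i))"
  using assms by (simp add: log_def ln_prod less_le sum_divide_distrib)

text \<open>If a factor vanishes, the logarithm of the product is not the sum of logarithms, but
  both sides then carry a factor 0.\<close>

lemma xlog_prod:
  assumes "finite I" "\<And>i. i \<in> I \<Longrightarrow> 0 \<le> f i"
  shows "xlog (\<Prod>i\<in>I. f i) = (\<Prod>i\<in>I. f i) * (\<Sum>i\<in>I. log 2 (f i))"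
proof (cases "(\<Prod>i\<in>I. f i) = 0")
  case False
  then have "\<And>i. i \<in> I \<Longrightarrow> f i \<noteq> 0" using assms(1) by auto
  then have "log 2 (\<Prod>i\<in>I. f i) = (\<Sum>i\<in>I. log 2 (f i))"
    using assms by (intro log_prod) (auto simp: less_le)
  then show ?thesis by (simp add: xlog_def)
qed (simp add: xlog_def)

text \<open>The noise entropy is the same for every input word, so it leaves every average over
  codewords as a constant.\<close>

lemma sum_xlog_bf_bsc:
  assumes "x \<in> words n" "\<And>j. 0 \<le> p j \<and> p j \<le> 1"
  shows "(\<Sum>y\<in>words n. xlog (bf_bsc p N s x y)) = - (\<Sum>i<n. bin_entropy (p (s ! (i div N))))"
proof -
  let ?w = "\<lambda>i. bsc (p (s ! (i div N))) (x ! i)"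
  have "(\<Sum>y\<in>words n. xlog (bf_bsc p N s x y)) =
        (\<Sum>y\<in>words n. (\<Prod>i<n. ?w i (y ! i)) * (\<Sum>i<n. log 2 (?w i (y ! i))))"
    using assms by (intro sum.cong refl) (simp add: bf_bsc_altdef xlog_prod bsc_nonneg)
  also have "\<dots> = (\<Sum>i<n. \<Sum>b\<in>UNIV. ?w i b * log 2 (?w i b))"
    unfolding words_eq_lists_of by (intro sum_lists_of_prod_mean) auto
  also have "\<dots> = (\<Sum>i<n. - bin_entropy (p (s ! (i div N))))"
    by (simp flip: xlog_def add: sum_xlog_bsc)
  finally show ?thesis by (simp add: sum_negf)
qed

text \<open>I(X;Z) \<le> I(X;Y) with both noise entropies constant, rearranged into a bound on the
  output entropy difference H(Z) - H(Y).\<close>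

lemma sum_xlog_joint_le:
  assumes "\<And>j. 0 \<le> p j \<and> p j \<le> pe j \<and> pe j \<le> 1/2"
    and r: "\<And>x. x \<in> words n \<Longrightarrow> 0 \<le> r x"
  shows "(\<Sum>y\<in>words n. xlog (\<Sum>x\<in>words n. r x * bf_bsc p N s x y))
       - (\<Sum>z\<in>words n. xlog (\<Sum>x\<in>words n. r x * bf_bsc pe N s x z)) \<le>
       (\<Sum>x\<in>words n. r x) * (\<Sum>i<n. bin_entropy (pe (s ! (i div N))) - bin_entropy (p (s ! (i div N))))"
proof -
  let ?t = "\<lambda>j. degradation (p j) (pe j)"
  have p: "0 \<le> p j \<and> p j \<le> 1" and pe: "0 \<le> pe j \<and> pe j \<le> 1" for j
    using assms(1)[of j] by auto
  have t: "0 \<le> ?t j \<and> ?t j \<le> 1" and pt: "p j * (1 - ?t j) + (1 - p j) * ?t j = pe j" for j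
    using degradation[of "p j" "pe j"] assms(1)[of j] by auto
  have "(\<Sum>x\<in>words n. r x * (\<Sum>z\<in>words n. xlog (bf_bsc pe N s x z)))
      - (\<Sum>z\<in>words n. xlog (\<Sum>x\<in>words n. r x * bf_bsc pe N s x z)) \<le>
      (\<Sum>x\<in>words n. r x * (\<Sum>y\<in>words n. xlog (bf_bsc p N s x y)))
      - (\<Sum>y\<in>words n. xlog (\<Sum>x\<in>words n. r x * bf_bsc p N s x y))"
    by (rule channel_data_processing[where V = "bf_bsc ?t N s"])
       (auto simp: r p t pt bf_bsc_nonneg sum_bf_bsc bf_bsc_compose)
  moreover have "(\<Sum>x\<in>words n. r x * (\<Sum>y\<in>words n. xlog (bf_bsc p' N s x y))) =
      - ((\<Sum>x\<in>words n. r x) * (\<Sum>i<n. bin_entropy (p' (s ! (i div N)))))"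
    if "\<And>j. 0 \<le> p' j \<and> p' j \<le> 1" for p'
    using that by (simp add: sum_xlog_bf_bsc sum_negf sum_distrib_right)
  ultimately show ?thesis
    using p pe by (simp add: sum_subtractf right_diff_distrib)
qed

text \<open>The degrading channel is symmetric, hence doubly stochastic, so H(Y) \<le> H(Z).\<close>

lemma sum_xlog_output_le:
  assumes "\<And>j. 0 \<le> p j \<and> p j \<le> pe j \<and> pe j \<le> 1/2"
    and r: "\<And>x. x \<in> words n \<Longrightarrow> 0 \<le> r x"
  shows "(\<Sum>z\<in>words n. xlog (\<Sum>x\<in>words n. r x * bf_bsc pe N s x z)) \<le>
         (\<Sum>y\<in>words n. xlog (\<Sum>x\<in>words n. r x * bf_bsc p N s x y))"
proof -
  let ?t = "\<lambda>j. degradation (p j) (pe j)"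
  have p: "0 \<le> p j \<and> p j \<le> 1" for j
    using assms(1)[of j] by auto
  have t: "0 \<le> ?t j \<and> ?t j \<le> 1" and pt: "p j * (1 - ?t j) + (1 - p j) * ?t j = pe j" for j
    using degradation[of "p j" "pe j"] assms(1)[of j] by auto
  have "(\<Sum>x\<in>words n. r x * bf_bsc pe N s x z) =
        (\<Sum>y\<in>words n. (\<Sum>x\<in>words n. r x * bf_bsc p N s x y) * bf_bsc ?t N s y z)" for z
  proof -
    have "(\<Sum>x\<in>words n. r x * bf_bsc pe N s x z) =
        (\<Sum>x\<in>words n. r x * (\<Sum>y\<in>words n. bf_bsc p N s x y * bf_bsc ?t N s y z))"
      by (simp add: bf_bsc_compose pt)
    also have "\<dots> = (\<Sum>y\<in>words n. (\<Sum>x\<in>words n. r x * bf_bsc p N s x y) * bf_bsc ?t N s y z)"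
      unfolding sum_distrib_right sum_distrib_left by (subst sum.swap) (simp add: mult.assoc)
    finally show ?thesis .
  qed
  moreover have "(\<Sum>z\<in>words n. xlog (\<Sum>y\<in>words n. (\<Sum>x\<in>words n. r x * bf_bsc p N s x y) * bf_bsc ?t N s y z))
     \<le> (\<Sum>y\<in>words n. xlog (\<Sum>x\<in>words n. r x * bf_bsc p N s x y))"
    by (intro xlog_sum_doubly_stochastic)
       (auto simp: r p t bf_bsc_nonneg sum_bf_bsc sum_bf_bsc' intro!: sum_nonneg mult_nonneg_nonneg)
  ultimately show ?thesis by simp
qed

section \<open>Averaging over the fading states\<close>

lemma state_prob_altdef:
  assumes "s \<in> states B"
  shows "state_prob q s = (\<Prod>j<B. (if s ! j = 1 then q else 1 - q))"
  using assms by (simp add: states_def state_prob_def)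

lemma state_prob_nonneg: "0 \<le> q \<Longrightarrow> q \<le> 1 \<Longrightarrow> 0 \<le> state_prob q s"
  by (auto simp: state_prob_def intro!: prod_nonneg)

lemma sum_state_prob: "(\<Sum>s\<in>states B. state_prob q s) = 1"
proof -
  have "(\<Sum>s\<in>states B. state_prob q s) = (\<Sum>s\<in>states B. \<Prod>j<B. (if s ! j = 1 then q else 1 - q))"
    by (intro sum.cong refl state_prob_altdef)
  also have "\<dots> = 1"
    unfolding states_eq_lists_of by (intro sum_lists_of_prod_one) auto
  finally show ?thesis .
qed

lemma sum_blocks: "(\<Sum>i<N * B. g (i div N)) = real N * (\<Sum>k<B. g k)" for g :: "nat \<Rightarrow> real"
proof -
  have "(\<Sum>i<N * B. g (i div N)) = (\<Sum>k<B. \<Sum>i\<in>{k * N..<k * N + N}. g (i div N))"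
    by (simp add: sum.nat_group mult.commute)
  also have "\<dots> = (\<Sum>k<B. \<Sum>i\<in>{k * N..<k * N + N}. g k)"
  proof (intro sum.cong refl)
    fix k i assume "i \<in> {k * N..<k * N + N}"
    then have "i div N = k" by (intro div_nat_eqI) (auto simp: mult.commute)
    then show "g (i div N) = g k" by simp
  qed
  finally show ?thesis by (simp add: sum_distrib_left)
qed

lemma sum_state_prob_mean:
  "(\<Sum>s\<in>states B. state_prob q s * (\<Sum>i<N * B. g (s ! (i div N)))) =
   real (N * B) * (q * g 1 + (1 - q) * g 2)"
proof -
  have "(\<Sum>s\<in>states B. state_prob q s * (\<Sum>i<N * B. g (s ! (i div N)))) =
        N * (\<Sum>s\<in>states B. (\<Prod>j<B. (if s ! j = 1 then q else 1 - q)) * (\<Sum>k<B. g (s ! k)))"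
    unfolding sum_blocks[of "\<lambda>k. g (s ! k)" for s]
    by (subst sum_distrib_left) (intro sum.cong refl, simp only: state_prob_altdef mult_ac)
  also have "(\<Sum>s\<in>states B. (\<Prod>j<B. (if s ! j = 1 then q else 1 - q)) * (\<Sum>k<B. g (s ! k))) =
        (\<Sum>k<B. \<Sum>a\<in>{1,2}. (if a = 1 then q else 1 - q) * g a)"
    unfolding states_eq_lists_of by (intro sum_lists_of_prod_mean) auto
  finally show ?thesis by simp
qed

section \<open>Error probability and leakage\<close>

lemma valid_encoderD:
  assumes "valid_encoder N B M enc" "m < M"
  shows "0 \<le> enc m x" "(\<Sum>x\<in>words (N * B). enc m x) = 1"
  using assms by (auto simp: valid_encoder_def)

lemma joint_mz_altdef:
  "joint_mz p N B M enc s m z = (\<Sum>x\<in>words (N * B). (enc m x / M) * bf_bsc p N s x z)"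
  by (simp add: joint_mz_def sum_divide_distrib)

lemma joint_mz_nonneg:
  assumes "valid_encoder N B M enc" "\<And>j. 0 \<le> p j \<and> p j \<le> 1" "m < M"
  shows "0 \<le> joint_mz p N B M enc s m z"
  unfolding joint_mz_altdef
  by (intro sum_nonneg mult_nonneg_nonneg divide_nonneg_nonneg bf_bsc_nonneg
      valid_encoderD(1)[OF assms(1,3)] assms(2)) simp

lemma sum_joint_mz:
  assumes "valid_encoder N B M enc" "0 < M"
  shows "(\<Sum>m<M. \<Sum>z\<in>words (N * B). joint_mz p N B M enc s m z) = 1"
proof -
  have "(\<Sum>z\<in>words (N * B). joint_mz p N B M enc s m z) = 1 / M" if "m < M" for m
    unfolding joint_mz_def sum_distrib_left[symmetric]
    by (subst sum.swap) (simp add: sum_bf_bsc valid_encoderD[OF assms(1) that] flip: sum_distrib_left)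
  then show ?thesis using assms by simp
qed

lemma err_prob_altdef:
  "err_prob q p N B M enc dec = (\<Sum>s\<in>states B. state_prob q s *
     (\<Sum>m<M. \<Sum>y\<in>words (N * B). joint_mz p N B M enc s m y * of_bool (dec y s \<noteq> m)))"
proof -
  have "(\<Sum>y\<in>words (N * B). joint_mz p N B M enc s m y * of_bool (dec y s \<noteq> m)) =
        1 / real M * (\<Sum>x\<in>words (N * B). enc m x *
          (\<Sum>y\<in>words (N * B). bf_bsc p N s x y * (if dec y s \<noteq> m then 1 else 0)))" for s m
    unfolding joint_mz_def sum_distrib_left sum_distrib_right of_bool_def
    by (subst sum.swap) (simp only: mult.assoc)
  then show ?thesis
    unfolding err_prob_def by (simp only: sum_distrib_left, subst sum.swap) (simp add: mult_ac)
qed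

lemma leakage_altdef:
  assumes "valid_encoder N B M enc" "0 < M" "\<And>j. 0 \<le> p j \<and> p j \<le> 1"
  shows "leakage q p N B M enc =
         (\<Sum>s\<in>states B. state_prob q s * mutual_info M (words (N * B)) (joint_mz p N B M enc s))"
proof -
  have if_zero: "(if a = 0 then 0 else a * b) = a * b" for a b :: real by simp
  show ?thesis
    unfolding leakage_def Let_def if_zero
    using assms by (simp only: mutual_info_altdef joint_mz_nonneg sum_joint_mz)
qed

section \<open>Converse\<close>

lemma log_card_le_fano:
  assumes "valid_encoder N B M enc" "0 < M" "\<And>j. 0 \<le> p j \<and> p j \<le> 1"
  shows "log 2 M \<le> mutual_info M (words (N * B)) (joint_mz p N B M enc s) + 1 +
           log 2 M * (\<Sum>m<M. \<Sum>y\<in>words (N * B). joint_mz p N B M enc s m y * of_bool (d y \<noteq> m))"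
  using fano[of "{..<M}" "words (N * B)" "joint_mz p N B M enc s" d]
    joint_mz_nonneg[OF assms(1,3)] sum_joint_mz[OF assms(1,2), of p s] assms(2)
  by (simp add: mutual_info_def lessThan_empty_iff)

text \<open>I(M;Y) - I(M;Z) equals [H(Z|M) - H(Y|M)] - [H(Z) - H(Y)]. The first bracket is bounded
  message by message through \<open>sum_xlog_joint_le\<close>; the second is nonnegative by
  \<open>sum_xlog_output_le\<close> for the input law averaged over messages.\<close>

lemma mutual_info_gap:
  assumes enc: "valid_encoder N B M enc" and M: "0 < M"
    and p: "\<And>j. 0 \<le> p j \<and> p j \<le> pe j \<and> pe j \<le> 1/2"
  shows "mutual_info M (words (N * B)) (joint_mz p N B M enc s) \<le>
         mutual_info M (words (N * B)) (joint_mz pe N B M enc s) +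
         (\<Sum>i<N * B. bin_entropy (pe (s ! (i div N))) - bin_entropy (p (s ! (i div N))))"
proof -
  let ?X = "words (N * B)"
  let ?D = "\<Sum>i<N * B. bin_entropy (pe (s ! (i div N))) - bin_entropy (p (s ! (i div N)))"
  have "(\<Sum>y\<in>?X. xlog (joint_mz p N B M enc s m y)) - (\<Sum>z\<in>?X. xlog (joint_mz pe N B M enc s m z)) \<le>
        1 / M * ?D" if "m < M" for m
  proof -
    have "(\<Sum>y\<in>?X. xlog (joint_mz p N B M enc s m y)) - (\<Sum>z\<in>?X. xlog (joint_mz pe N B M enc s m z)) \<le>
        (\<Sum>x\<in>?X. enc m x / M) * ?D"
      unfolding joint_mz_altdef using valid_encoderD(1)[OF enc that]
      by (intro sum_xlog_joint_le p) simp
    also have "(\<Sum>x\<in>?X. enc m x / M) = 1 / M"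
      using valid_encoderD(2)[OF enc that] by (simp flip: sum_divide_distrib)
    finally show ?thesis .
  qed
  then have "(\<Sum>m<M. (\<Sum>y\<in>?X. xlog (joint_mz p N B M enc s m y)) -
      (\<Sum>z\<in>?X. xlog (joint_mz pe N B M enc s m z))) \<le> (\<Sum>m<M. 1 / M * ?D)"
    by (intro sum_mono) simp
  then have joint: "(\<Sum>m<M. \<Sum>y\<in>?X. xlog (joint_mz p N B M enc s m y)) -
      (\<Sum>m<M. \<Sum>z\<in>?X. xlog (joint_mz pe N B M enc s m z)) \<le> ?D"
    using M by (simp add: sum_subtractf)
  have marginal: "(\<Sum>m<M. joint_mz p' N B M enc s m y) =
      (\<Sum>x\<in>?X. (\<Sum>m<M. enc m x / M) * bf_bsc p' N s x y)" for p' y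
    unfolding joint_mz_altdef by (subst sum.swap) (simp only: sum_distrib_right)
  have "(\<Sum>z\<in>?X. xlog (\<Sum>m<M. joint_mz pe N B M enc s m z)) \<le>
        (\<Sum>y\<in>?X. xlog (\<Sum>m<M. joint_mz p N B M enc s m y))"
    unfolding marginal using valid_encoderD(1)[OF enc]
    by (intro sum_xlog_output_le p sum_nonneg) simp
  with joint show ?thesis by (simp add: mutual_info_def)
qed

text \<open>Fano's inequality and the gap bound hold for each state sequence, with decoder
  \<open>\<lambda>y. dec y s\<close>; all terms are linear in the state weights.\<close>

lemma converse_finite:
  assumes enc: "valid_encoder N B M enc" and M: "0 < M"
    and p: "\<And>j. 0 \<le> p j \<and> p j \<le> pe j \<and> pe j \<le> 1/2" and q: "0 \<le> q" "q \<le> 1"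
  shows "log 2 M \<le> leakage q pe N B M enc + 1 + log 2 M * err_prob q p N B M enc dec +
           real (N * B) * (q * (bin_entropy (pe 1) - bin_entropy (p 1)) +
                           (1 - q) * (bin_entropy (pe 2) - bin_entropy (p 2)))"
proof -
  let ?X = "words (N * B)"
  let ?I = "\<lambda>s. mutual_info M ?X (joint_mz pe N B M enc s)"
  let ?E = "\<lambda>s. \<Sum>m<M. \<Sum>y\<in>?X. joint_mz p N B M enc s m y * of_bool (dec y s \<noteq> m)"
  let ?D = "\<lambda>s. \<Sum>i<N * B. bin_entropy (pe (s ! (i div N))) - bin_entropy (p (s ! (i div N)))"
  have p': "0 \<le> p j \<and> p j \<le> 1" "0 \<le> pe j \<and> pe j \<le> 1" for j using p[of j] by auto
  have "log 2 M = (\<Sum>s\<in>states B. state_prob q s * log 2 M)"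
    by (simp add: sum_state_prob flip: sum_distrib_right)
  also have "\<dots> \<le> (\<Sum>s\<in>states B. state_prob q s * (?I s + 1 + log 2 M * ?E s + ?D s))"
  proof (intro sum_mono mult_left_mono state_prob_nonneg q)
    fix s
    show "log 2 M \<le> ?I s + 1 + log 2 M * ?E s + ?D s"
      using log_card_le_fano[where p = p and s = s and d = "\<lambda>y. dec y s", OF enc M p'(1)]
        mutual_info_gap[where p = p and pe = pe and s = s, OF enc M p]
      by linarith
  qed
  also have "\<dots> = (\<Sum>s\<in>states B. state_prob q s * ?I s) + (\<Sum>s\<in>states B. state_prob q s) +
      log 2 M * (\<Sum>s\<in>states B. state_prob q s * ?E s) + (\<Sum>s\<in>states B. state_prob q s * ?D s)"
    by (simp only: distrib_left sum.distrib mult_1_right sum_distrib_left mult.left_commute)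
  also have "(\<Sum>s\<in>states B. state_prob q s * ?D s) =
      real (N * B) * (q * (bin_entropy (pe 1) - bin_entropy (p 1)) +
                           (1 - q) * (bin_entropy (pe 2) - bin_entropy (p 2)))"
    by (rule sum_state_prob_mean[where q = q and N = N and B = B and g = "\<lambda>j. bin_entropy (pe j) - bin_entropy (p j)"])
  finally show ?thesis
    by (simp only: err_prob_altdef leakage_altdef[OF enc M p'(2)] sum_state_prob)
qed

lemma converse:
  assumes ach: "achievable_csid q p pe R"
    and p: "\<And>j. 0 \<le> p j \<and> p j \<le> pe j \<and> pe j \<le> 1/2" and q: "0 \<le> q" "q \<le> 1"
  shows "R \<le> q * (bin_entropy (pe 1) - bin_entropy (p 1)) + (1 - q) * (bin_entropy (pe 2) - bin_entropy (p 2))"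
    (is "R \<le> ?C")
proof (rule field_le_epsilon)
  fix \<epsilon> :: real assume \<epsilon>: "0 < \<epsilon>"
  from ach obtain N B M enc dec where
    lim: "filterlim N at_top sequentially" "filterlim B at_top sequentially"
    and code: "\<And>k. 0 < N k \<and> 0 < B k \<and> 1 \<le> M k \<and> valid_encoder (N k) (B k) (M k) (enc k)"
    and rate: "eventually (\<lambda>k. log 2 (real (M k)) / real (N k * B k) \<ge> R - \<epsilon>) sequentially"
    and err: "(\<lambda>k. err_prob q p (N k) (B k) (M k) (enc k) (dec k)) \<longlonglongrightarrow> 0"
    and leak: "(\<lambda>k. leakage q pe (N k) (B k) (M k) (enc k) / real (N k * B k)) \<longlonglongrightarrow> 0"
    using \<epsilon> unfolding achievable_csid_def by blast
  let ?n = "\<lambda>k. real (N k * B k)"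
  let ?e = "\<lambda>k. err_prob q p (N k) (B k) (M k) (enc k) (dec k)"
  let ?l = "\<lambda>k. leakage q pe (N k) (B k) (M k) (enc k) / ?n k"
  have "filterlim ?n at_top sequentially"
    unfolding of_nat_mult
    by (intro filterlim_at_top_mult_at_top filterlim_compose[OF filterlim_real_sequentially] lim)
  then have inv: "(\<lambda>k. 1 / ?n k) \<longlonglongrightarrow> 0"
    by (intro tendsto_divide_0[OF tendsto_const] filterlim_at_top_imp_at_infinity)
  \<comment> \<open>Keeps \<open>1 - ?e k\<close> positive, so that the lower bound on the rate may
    be multiplied by it.\<close>
  have "eventually (\<lambda>k. ?e k < 1) sequentially"
    using err by (rule order_tendstoD) simp
  with rate have "eventually (\<lambda>k. (R - \<epsilon>) * (1 - ?e k) \<le> ?l k + 1 / ?n k + ?C) sequentially"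
  proof eventually_elim
    case (elim k)
    have n: "0 < ?n k" using code[of k] by simp
    \<comment> \<open>Fano's error term is absorbed on the left: the rate has no a priori upper
      bound here, so the vanishing error alone would not make that term small.\<close>
    have "log 2 (M k) * (1 - ?e k) \<le> leakage q pe (N k) (B k) (M k) (enc k) + 1 + ?n k * ?C"
      using converse_finite[of "N k" "B k" "M k" "enc k" p pe q "dec k"] code[of k] p q
      by (simp add: algebra_simps)
    then have "log 2 (M k) * (1 - ?e k) / ?n k \<le>
        (leakage q pe (N k) (B k) (M k) (enc k) + 1 + ?n k * ?C) / ?n k"
      using n by (intro divide_right_mono) auto
    also have "\<dots> = ?l k + 1 / ?n k + ?C"
      using n by (simp only: add_divide_distrib nonzero_mult_div_cancel_left less_imp_neq[symmetric] not_False_eq_True)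
    finally have "log 2 (M k) / ?n k * (1 - ?e k) \<le> ?l k + 1 / ?n k + ?C"
      by simp
    moreover have "(R - \<epsilon>) * (1 - ?e k) \<le> log 2 (M k) / ?n k * (1 - ?e k)"
      using elim by (intro mult_right_mono) auto
    ultimately show ?case by linarith
  qed
  moreover have "(\<lambda>k. (R - \<epsilon>) * (1 - ?e k)) \<longlonglongrightarrow> (R - \<epsilon>) * (1 - 0)"
    by (intro tendsto_intros err)
  moreover have "(\<lambda>k. ?l k + 1 / ?n k + ?C) \<longlonglongrightarrow> 0 + 0 + ?C"
    by (intro tendsto_add leak inv tendsto_const)
  ultimately have "(R - \<epsilon>) * (1 - 0) \<le> 0 + 0 + ?C"
    by (intro tendsto_le[OF sequentially_bot]) 
  then show "R \<le> ?C + \<epsilon>" by simp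
qed

section \<open>Typical sets\<close>

lemma sum_bsc_UNIV: "(\<Sum>b\<in>UNIV. g (bsc q a b)) = g q + g (1 - q)" for g :: "real \<Rightarrow> real"
  by (cases a; simp add: bsc_def UNIV_bool)

text \<open>Variance of the information density \<open>- log 2\<close> of the transition probability
  in one use of BSC(\<open>q\<close>), whose mean is \<open>bin_entropy q\<close>. By symmetry the
  input \<open>True\<close> represents both letters.\<close>

definition varentropy :: "real \<Rightarrow> real" where
  "varentropy q = (\<Sum>b\<in>UNIV. bsc q True b * (bin_entropy q + log 2 (bsc q True b))\<^sup>2)"

lemma varentropy: "(\<Sum>b\<in>UNIV. bsc q a b * (- log 2 (bsc q a b) - bin_entropy q)\<^sup>2) = varentropy q"
  unfolding varentropy_def
  using sum_bsc_UNIV[of "\<lambda>x. x * (- log 2 x - bin_entropy q)\<^sup>2" q a]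
    sum_bsc_UNIV[of "\<lambda>x. x * (bin_entropy q + log 2 x)\<^sup>2" q True]
  by (simp add: power2_eq_square algebra_simps)

definition mean_entropy :: "real \<Rightarrow> (nat \<Rightarrow> real) \<Rightarrow> real" where
  "mean_entropy q p = q * bin_entropy (p 1) + (1 - q) * bin_entropy (p 2)"

text \<open>Law of total variance for one letter in a random state: mean conditional variance plus
  variance of the conditional mean.\<close>

definition spread :: "real \<Rightarrow> (nat \<Rightarrow> real) \<Rightarrow> real" where
  "spread q p = q * varentropy (p 1) + (1 - q) * varentropy (p 2) +
     (q * (bin_entropy (p 1) - mean_entropy q p)\<^sup>2 + (1 - q) * (bin_entropy (p 2) - mean_entropy q p)\<^sup>2)"

text \<open>Given the states, the information density has independent summands and conditional mean
  \<open>\<Sum>i. bin_entropy (p (s ! (i div N)))\<close>; this mean itself fluctuates with the states only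
  through a sum over \<open>B\<close> independent blocks, which accounts for the factor \<open>N\<^sup>2 * B\<close>.\<close>
lemma information_density_second_moment:
  assumes x: "x \<in> words (N * B)" and q: "0 \<le> q" "q \<le> 1" and p: "\<And>j. 0 \<le> p j \<and> p j \<le> 1"
  shows "(\<Sum>s\<in>states B. state_prob q s * (\<Sum>y\<in>words (N * B). bf_bsc p N s x y *
            ((\<Sum>i<N * B. - log 2 (bsc (p (s ! (i div N))) (x ! i) (y ! i)))
               - real (N * B) * mean_entropy q p)\<^sup>2))
       \<le> real N ^ 2 * real B * spread q p"
proof -
  let ?n = "N * B" and ?h = "\<lambda>j. bin_entropy (p j)" and ?m = "mean_entropy q p"
  let ?w = "\<lambda>s i. bsc (p (s ! (i div N))) (x ! i)"
  let ?u = "\<lambda>s. \<Sum>i<?n. ?h (s ! (i div N)) - ?m"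
  let ?f = "\<lambda>s i b. - log 2 (?w s i b) - ?h (s ! (i div N))"
  let ?V = "\<lambda>s. \<Sum>i<?n. varentropy (p (s ! (i div N)))"
  have inner: "(\<Sum>y\<in>words ?n. bf_bsc p N s x y *
            ((\<Sum>i<?n. - log 2 (?w s i (y ! i))) - real ?n * ?m)\<^sup>2) = (?u s)\<^sup>2 + ?V s" for s
  proof -
    have "(\<Sum>y\<in>words ?n. bf_bsc p N s x y * ((\<Sum>i<?n. - log 2 (?w s i (y ! i))) - real ?n * ?m)\<^sup>2) =
          (\<Sum>y\<in>words ?n. (\<Prod>i<?n. ?w s i (y ! i)) * (?u s + (\<Sum>i<?n. ?f s i (y ! i)))\<^sup>2)"
      by (simp add: bf_bsc_altdef[OF x] sum_subtractf)
    also have "\<dots> = (?u s)\<^sup>2 + (\<Sum>i<?n. \<Sum>b\<in>UNIV. ?w s i b * (?f s i b)\<^sup>2)"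
      unfolding words_eq_lists_of
    proof (rule sum_lists_of_prod_variance)
      fix i
      have "(\<Sum>b\<in>UNIV. ?w s i b * ?f s i b) =
            - (\<Sum>b\<in>UNIV. xlog (?w s i b)) - (\<Sum>b\<in>UNIV. ?w s i b) * ?h (s ! (i div N))"
        by (simp add: xlog_def right_diff_distrib sum_subtractf sum_negf flip: sum_distrib_right)
      then show "(\<Sum>b\<in>UNIV. ?w s i b * ?f s i b) = 0"
        by (simp add: sum_xlog_bsc)
    qed simp_all
    finally show ?thesis by (simp only: varentropy)
  qed
  have "(\<Sum>s\<in>states B. state_prob q s * (?u s)\<^sup>2) =
        (\<Sum>s\<in>states B. (\<Prod>j<B. (if s ! j = 1 then q else 1 - q)) *
           (0 + (\<Sum>k<B. real N * (?h (s ! k) - ?m)))\<^sup>2)"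
  proof (intro sum.cong refl)
    fix s assume s: "s \<in> states B"
    have "?u s = real N * (\<Sum>k<B. ?h (s ! k) - ?m)"
      by (rule sum_blocks)
    then show "state_prob q s * (?u s)\<^sup>2 = (\<Prod>j<B. (if s ! j = 1 then q else 1 - q)) *
           (0 + (\<Sum>k<B. real N * (?h (s ! k) - ?m)))\<^sup>2"
      by (simp only: state_prob_altdef[OF s] add_0 flip: sum_distrib_left)
  qed
  also have "\<dots> = 0\<^sup>2 + (\<Sum>k<B. \<Sum>a\<in>{1,2}. (if a = 1 then q else 1 - q) * (real N * (?h a - ?m))\<^sup>2)"
    unfolding states_eq_lists_of
    by (rule sum_lists_of_prod_variance) (auto simp: mean_entropy_def algebra_simps)
  also have "\<dots> = real N ^ 2 * real B * (q * (?h 1 - ?m)\<^sup>2 + (1 - q) * (?h 2 - ?m)\<^sup>2)"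
    unfolding power_mult_distrib by (simp add: algebra_simps)
  finally have outer: "(\<Sum>s\<in>states B. state_prob q s * (?u s)\<^sup>2) =
      real N ^ 2 * real B * (q * (?h 1 - ?m)\<^sup>2 + (1 - q) * (?h 2 - ?m)\<^sup>2)" .
  have var_nonneg: "0 \<le> q * varentropy (p 1) + (1 - q) * varentropy (p 2)"
    using q p by (auto simp: varentropy_def bsc_nonneg intro!: add_nonneg_nonneg mult_nonneg_nonneg sum_nonneg)
  \<comment> \<open>The letter noise has only order \<open>N * B\<close>; this crude bound merges it
    with the dominant state term.\<close>
  have "real (N * B) \<le> real N ^ 2 * real B"
    by (cases N) (auto simp: power2_eq_square algebra_simps)
  then have "real (N * B) * (q * varentropy (p 1) + (1 - q) * varentropy (p 2)) \<le>
        real N ^ 2 * real B * (q * varentropy (p 1) + (1 - q) * varentropy (p 2))"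
    using var_nonneg by (rule mult_right_mono)
  then show ?thesis
    unfolding inner distrib_left sum.distrib outer spread_def
    using sum_state_prob_mean[where q = q and N = N and B = B and g = "\<lambda>j. varentropy (p j)"] by (simp add: algebra_simps)
qed

text \<open>Chebyshev's inequality: a transition probability below the threshold puts the
  information density at least \<open>N * B * \<delta>\<close> above its mean. The block length
  cancels.\<close>

lemma atypical_prob_le:
  assumes x: "x \<in> words (N * B)" and q: "0 \<le> q" "q \<le> 1" and p: "\<And>j. 0 \<le> p j \<and> p j \<le> 1"
    and pos: "0 < N" "0 < B" "0 < \<delta>"
  defines "\<theta> \<equiv> real (N * B) * (mean_entropy q p + \<delta>)"
  shows "(\<Sum>s\<in>states B. state_prob q s * (\<Sum>y\<in>words (N * B). bf_bsc p N s x y *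
            of_bool (bf_bsc p N s x y < 2 powr - \<theta>))) \<le> spread q p / (real B * \<delta>\<^sup>2)"
proof -
  let ?n = "real (N * B)"
  let ?Z = "\<lambda>s y. (\<Sum>i<N * B. - log 2 (bsc (p (s ! (i div N))) (x ! i) (y ! i))) - ?n * mean_entropy q p"
  have n: "0 < ?n" using pos by simp
  have step: "bf_bsc p N s x y * of_bool (bf_bsc p N s x y < 2 powr - \<theta>) \<le>
        bf_bsc p N s x y * (?Z s y)\<^sup>2 / (?n * \<delta>)\<^sup>2" for s y
  \<comment> \<open>Words of probability zero carry no weight. For the others every factor is
    positive, so the logarithm of the product is a genuine sum.\<close>
  proof (cases "0 < bf_bsc p N s x y \<and> bf_bsc p N s x y < 2 powr - \<theta>")
    case True
    have "bsc (p (s ! (i div N))) (x ! i) (y ! i) \<noteq> 0" if "i < N * B" for i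
    proof
      assume "bsc (p (s ! (i div N))) (x ! i) (y ! i) = 0"
      then have "bf_bsc p N s x y = 0"
        using that unfolding bf_bsc_altdef[OF x] by (intro prod_zero) auto
      with True show False by simp
    qed
    then have "0 < bsc (p (s ! (i div N))) (x ! i) (y ! i)" if "i < N * B" for i
      using p that by (simp add: bsc_nonneg less_le)
    then have "log 2 (bf_bsc p N s x y) = (\<Sum>i<N * B. log 2 (bsc (p (s ! (i div N))) (x ! i) (y ! i)))"
      unfolding bf_bsc_altdef[OF x] by (intro log_prod) auto
    moreover have "log 2 (bf_bsc p N s x y) < - \<theta>"
      using True by (simp add: log_less_iff)
    ultimately have "?n * \<delta> \<le> ?Z s y"
      by (simp add: \<theta>_def sum_negf algebra_simps)
    then have "(?n * \<delta>)\<^sup>2 \<le> (?Z s y)\<^sup>2"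
      using n pos by (intro power_mono) auto
    then have "1 \<le> (?Z s y)\<^sup>2 / (?n * \<delta>)\<^sup>2"
      using n pos by simp
    then show ?thesis
      using True mult_left_mono[of 1 "(?Z s y)\<^sup>2 / (?n * \<delta>)\<^sup>2" "bf_bsc p N s x y"] by simp
  next
    case False
    then show ?thesis using bf_bsc_nonneg[where p = p and N = N and s = s and x = x and y = y, OF p] by auto
  qed
  have "(\<Sum>s\<in>states B. state_prob q s * (\<Sum>y\<in>words (N * B). bf_bsc p N s x y *
            of_bool (bf_bsc p N s x y < 2 powr - \<theta>))) \<le>
        (\<Sum>s\<in>states B. state_prob q s * (\<Sum>y\<in>words (N * B). bf_bsc p N s x y * (?Z s y)\<^sup>2 / (?n * \<delta>)\<^sup>2))"
    by (intro sum_mono mult_left_mono step state_prob_nonneg q)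
  also have "\<dots> = (\<Sum>s\<in>states B. state_prob q s * (\<Sum>y\<in>words (N * B). bf_bsc p N s x y * (?Z s y)\<^sup>2)) / (?n * \<delta>)\<^sup>2"
    by (simp only: sum_divide_distrib sum_distrib_left times_divide_eq_right)
  also have "\<dots> \<le> (real N ^ 2 * real B * spread q p) / (?n * \<delta>)\<^sup>2"
    by (intro divide_right_mono information_density_second_moment x q p) simp
  also have "\<dots> = spread q p / (real B * \<delta>\<^sup>2)"
    using pos by (simp add: power2_eq_square)
  finally show ?thesis .
qed

text \<open>For fixed \<open>y\<close> the transition probabilities sum to 1 over the inputs, so few
  inputs can reach \<open>2 powr - \<theta>\<close>.\<close>

lemma typical_count_le:
  assumes "y \<in> words n" "\<And>j. 0 \<le> p j \<and> p j \<le> 1"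
  shows "(\<Sum>x\<in>words n. of_bool (2 powr - \<theta> \<le> bf_bsc p N s x y)) \<le> 2 powr \<theta>"
proof -
  have "(\<Sum>x\<in>words n. of_bool (2 powr - \<theta> \<le> bf_bsc p N s x y)) \<le>
        (\<Sum>x\<in>words n. bf_bsc p N s x y * 2 powr \<theta>)"
  proof (rule sum_mono)
    fix x
    show "of_bool (2 powr - \<theta> \<le> bf_bsc p N s x y) \<le> bf_bsc p N s x y * 2 powr \<theta>"
      using bf_bsc_nonneg[where p = p and N = N and s = s and x = x and y = y, OF assms(2)]
      by (auto simp: of_bool_def powr_minus field_simps)
  qed
  then show ?thesis
    using sum_bf_bsc'[OF assms(1), of p N s] by (simp flip: sum_distrib_right)
qed

section \<open>Random coding\<close>

text \<open>Redrawing one uniform codeword leaves the average unchanged: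
  \<open>(c, a) \<mapsto> (c(j := a), c j)\<close> is an involution.\<close>

lemma sum_PiE_resample:
  fixes f :: "('i \<Rightarrow> 'a) \<Rightarrow> real"
  assumes "j \<in> I"
  shows "(\<Sum>c\<in>I \<rightarrow>\<^sub>E A. \<Sum>a\<in>A. f (c(j := a))) = real (card A) * (\<Sum>c\<in>I \<rightarrow>\<^sub>E A. f c)"
proof -
  have "(\<Sum>c\<in>I \<rightarrow>\<^sub>E A. \<Sum>a\<in>A. f (c(j := a))) = (\<Sum>(c, a)\<in>(I \<rightarrow>\<^sub>E A) \<times> A. f (c(j := a)))"
    by (simp add: sum.cartesian_product)
  also have "\<dots> = (\<Sum>(c, a)\<in>(I \<rightarrow>\<^sub>E A) \<times> A. f c)"
    by (rule sum.reindex_bij_witness[of _ "\<lambda>(c, a). (c(j := a), c j)" "\<lambda>(c, a). (c(j := a), c j)"])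
       (use assms in \<open>auto simp: PiE_iff extensional_def\<close>)
  also have "\<dots> = real (card A) * (\<Sum>c\<in>I \<rightarrow>\<^sub>E A. f c)"
    by (simp add: sum_distrib_left flip: sum.cartesian_product)
  finally show ?thesis .
qed

text \<open>Resampling codeword \<open>j\<close> does not touch \<open>c i\<close>, so the wrong
  codeword can be averaged first with \<open>y\<close> held fixed; at most a fraction
  \<open>2 powr (\<theta> - n)\<close> of the words is typical with \<open>y\<close>.\<close>

lemma sum_codebooks_collision_le:
  assumes fin: "finite I" and ij: "i \<in> I" "j \<in> I" "i \<noteq> j" and p: "\<And>j. 0 \<le> p j \<and> p j \<le> 1"
  shows "(\<Sum>c\<in>I \<rightarrow>\<^sub>E words n. \<Sum>y\<in>words n. bf_bsc p N s (c i) y * of_bool (2 powr - \<theta> \<le> bf_bsc p N s (c j) y))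
       \<le> real (card (I \<rightarrow>\<^sub>E words n)) * 2 powr (\<theta> - n)"
proof -
  let ?W = "bf_bsc p N s"
  let ?F = "I \<rightarrow>\<^sub>E words n"
  let ?S = "\<Sum>c\<in>?F. \<Sum>y\<in>words n. ?W (c i) y * of_bool (2 powr - \<theta> \<le> ?W (c j) y)"
  have "2 ^ n * ?S = (\<Sum>c\<in>?F. \<Sum>a\<in>words n. \<Sum>y\<in>words n. ?W (c i) y * of_bool (2 powr - \<theta> \<le> ?W a y))"
    using sum_PiE_resample[of j I "\<lambda>c. \<Sum>y\<in>words n. ?W (c i) y * of_bool (2 powr - \<theta> \<le> ?W (c j) y)" "words n"] ij
    by (simp add: card_words)
  also have "\<dots> = (\<Sum>c\<in>?F. \<Sum>y\<in>words n. ?W (c i) y * (\<Sum>a\<in>words n. of_bool (2 powr - \<theta> \<le> ?W a y)))"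
    unfolding sum_distrib_left by (intro sum.cong refl sum.swap)
  also have "\<dots> \<le> (\<Sum>c\<in>?F. \<Sum>y\<in>words n. ?W (c i) y * 2 powr \<theta>)"
    by (intro sum_mono mult_left_mono typical_count_le bf_bsc_nonneg p)
  also have "\<dots> = (\<Sum>c\<in>?F. 2 powr \<theta>)"
  proof (rule sum.cong[OF refl])
    fix c assume "c \<in> ?F"
    then have "c i \<in> words n" using ij by (auto simp: PiE_iff)
    then show "(\<Sum>y\<in>words n. ?W (c i) y * 2 powr \<theta>) = 2 powr \<theta>"
      by (simp add: sum_bf_bsc flip: sum_distrib_right)
  qed
  finally have "2 ^ n * ?S \<le> real (card ?F) * 2 powr \<theta>" by simp
  then show ?thesis
    by (simp add: powr_diff powr_realpow field_simps)
qed

text \<open>The choice is relied upon only when the true codeword is the sole typical one; all other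
  cases are charged as errors.\<close>

definition typical_decode :: "('a \<Rightarrow> 'b \<Rightarrow> real) \<Rightarrow> real \<Rightarrow> 'i set \<Rightarrow> ('i \<Rightarrow> 'a) \<Rightarrow> 'b \<Rightarrow> 'i" where
  "typical_decode W \<theta> J c y = (SOME j. j \<in> J \<and> 2 powr - \<theta> \<le> W (c j) y)"

lemma typical_decode_error_le:
  assumes "finite J" "i \<in> J"
  shows "of_bool (typical_decode W \<theta> J c y \<noteq> i) \<le>
         of_bool (W (c i) y < 2 powr - \<theta>) + (\<Sum>j\<in>J - {i}. of_bool (2 powr - \<theta> \<le> W (c j) y) :: real)"
proof (cases "W (c i) y < 2 powr - \<theta> \<or> (\<exists>j\<in>J - {i}. 2 powr - \<theta> \<le> W (c j) y)")
  case True
  have nonneg: "0 \<le> (\<Sum>j\<in>J - {i}. of_bool (2 powr - \<theta> \<le> W (c j) y) :: real)"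
    by (intro sum_nonneg) simp
  from True show ?thesis
  proof
    assume "\<exists>j\<in>J - {i}. 2 powr - \<theta> \<le> W (c j) y"
    then obtain j where j: "j \<in> J - {i}" "2 powr - \<theta> \<le> W (c j) y" by blast
    then have "of_bool (2 powr - \<theta> \<le> W (c j) y) \<le> (\<Sum>j\<in>J - {i}. of_bool (2 powr - \<theta> \<le> W (c j) y) :: real)"
      using assms by (intro member_le_sum) auto
    with j show ?thesis by (simp add: of_bool_def)
  qed (use nonneg in \<open>simp add: of_bool_def\<close>)
next
  case False
  then have "typical_decode W \<theta> J c y = i"
    unfolding typical_decode_def using assms by (intro some_equality) (auto simp: not_less)
  then show ?thesis by (simp add: sum_nonneg)
qed

definition threshold :: "real \<Rightarrow> (nat \<Rightarrow> real) \<Rightarrow> nat \<Rightarrow> nat \<Rightarrow> real \<Rightarrow> real" where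
  "threshold q p N B \<delta> = real (N * B) * (mean_entropy q p + \<delta>)"

text \<open>\<open>J\<close> is the list known to contain the true index: all of \<open>I\<close>
  for the legitimate receiver, the codewords of one message for the eavesdropper. The exact number
  \<open>card J - 1\<close> of competitors matters: with a single candidate there is no collision,
  even if \<open>2 powr (\<theta> - real (N * B))\<close> is huge.\<close>

lemma sum_codebooks_error_le:
  assumes fin: "finite I" and J: "i \<in> J" "J \<subseteq> I" and q: "0 \<le> q" "q \<le> 1"
    and p: "\<And>j. 0 \<le> p j \<and> p j \<le> 1" and pos: "0 < N" "0 < B" "0 < \<delta>"
  defines "\<theta> \<equiv> threshold q p N B \<delta>"
  shows "(\<Sum>c\<in>I \<rightarrow>\<^sub>E words (N * B). \<Sum>s\<in>states B. state_prob q s * (\<Sum>y\<in>words (N * B).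
            bf_bsc p N s (c i) y * of_bool (typical_decode (bf_bsc p N s) \<theta> J c y \<noteq> i)))
       \<le> real (card (I \<rightarrow>\<^sub>E words (N * B))) *
           (spread q p / (real B * \<delta>\<^sup>2) + (real (card J) - 1) * 2 powr (\<theta> - real (N * B)))"
proof -
  let ?X = "words (N * B)" and ?F = "I \<rightarrow>\<^sub>E words (N * B)"
  let ?W = "bf_bsc p N"
  let ?A = "\<lambda>c s. \<Sum>y\<in>?X. ?W s (c i) y * of_bool (?W s (c i) y < 2 powr - \<theta>)"
  let ?C = "\<lambda>c s j. \<Sum>y\<in>?X. ?W s (c i) y * of_bool (2 powr - \<theta> \<le> ?W s (c j) y)"
  have finJ: "finite J" using fin J finite_subset by blast
  have cardJ: "real (card (J - {i})) = real (card J) - 1"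
    using card_Suc_Diff1[OF finJ J(1)] by linarith
  have "(\<Sum>y\<in>?X. ?W s (c i) y * of_bool (typical_decode (?W s) \<theta> J c y \<noteq> i)) \<le>
        ?A c s + (\<Sum>j\<in>J - {i}. ?C c s j)" for c s
  proof -
    have "(\<Sum>y\<in>?X. ?W s (c i) y * of_bool (typical_decode (?W s) \<theta> J c y \<noteq> i)) \<le>
       (\<Sum>y\<in>?X. ?W s (c i) y * (of_bool (?W s (c i) y < 2 powr - \<theta>) +
          (\<Sum>j\<in>J - {i}. of_bool (2 powr - \<theta> \<le> ?W s (c j) y))))"
      by (intro sum_mono mult_left_mono typical_decode_error_le finJ J bf_bsc_nonneg p)
    also have "\<dots> = ?A c s + (\<Sum>y\<in>?X. \<Sum>j\<in>J - {i}. ?W s (c i) y * of_bool (2 powr - \<theta> \<le> ?W s (c j) y))"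
      by (simp only: distrib_left sum.distrib sum_distrib_left)
    also have "(\<Sum>y\<in>?X. \<Sum>j\<in>J - {i}. ?W s (c i) y * of_bool (2 powr - \<theta> \<le> ?W s (c j) y)) =
        (\<Sum>j\<in>J - {i}. ?C c s j)"
      by (rule sum.swap)
    finally show ?thesis .
  qed
  then have "(\<Sum>c\<in>?F. \<Sum>s\<in>states B. state_prob q s * (\<Sum>y\<in>?X.
        ?W s (c i) y * of_bool (typical_decode (?W s) \<theta> J c y \<noteq> i))) \<le>
      (\<Sum>c\<in>?F. \<Sum>s\<in>states B. state_prob q s * (?A c s + (\<Sum>j\<in>J - {i}. ?C c s j)))"
    by (intro sum_mono mult_left_mono state_prob_nonneg q)
  also have "\<dots> = (\<Sum>c\<in>?F. \<Sum>s\<in>states B. state_prob q s * ?A c s) +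
                 (\<Sum>c\<in>?F. \<Sum>s\<in>states B. state_prob q s * (\<Sum>j\<in>J - {i}. ?C c s j))"
    by (simp only: distrib_left sum.distrib)
  also have "(\<Sum>c\<in>?F. \<Sum>s\<in>states B. state_prob q s * (\<Sum>j\<in>J - {i}. ?C c s j)) =
             (\<Sum>s\<in>states B. state_prob q s * (\<Sum>j\<in>J - {i}. \<Sum>c\<in>?F. ?C c s j))"
    by (subst sum.swap, simp only: flip: sum_distrib_left, subst sum.swap, rule refl)
  also have "(\<Sum>c\<in>?F. \<Sum>s\<in>states B. state_prob q s * ?A c s) \<le>
             (\<Sum>c\<in>?F. spread q p / (real B * \<delta>\<^sup>2))"
  proof (rule sum_mono)
    fix c assume "c \<in> ?F"
    then have "c i \<in> ?X" using J by (auto simp: PiE_iff)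
    then show "(\<Sum>s\<in>states B. state_prob q s * ?A c s) \<le> spread q p / (real B * \<delta>\<^sup>2)"
      unfolding \<theta>_def threshold_def using q p pos by (rule atypical_prob_le)
  qed
  also have "(\<Sum>s\<in>states B. state_prob q s * (\<Sum>j\<in>J - {i}. \<Sum>c\<in>?F. ?C c s j)) \<le>
             (\<Sum>s\<in>states B. state_prob q s * (\<Sum>j\<in>J - {i}. real (card ?F) * 2 powr (\<theta> - real (N * B))))"
    using J by (intro sum_mono mult_left_mono sum_codebooks_collision_le state_prob_nonneg q fin p) auto
  also have "\<dots> = real (card ?F) * ((real (card J) - 1) * 2 powr (\<theta> - real (N * B)))"
    using cardJ by (simp add: sum_state_prob flip: sum_distrib_right)
  finally show ?thesis by (simp add: distrib_left)
qed

lemma exists_le_average: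
  fixes G :: "'a \<Rightarrow> real"
  assumes "finite F" "F \<noteq> {}" "(\<Sum>c\<in>F. G c) \<le> real (card F) * \<beta>"
  obtains c where "c \<in> F" "G c \<le> \<beta>"
proof -
  have "\<exists>c\<in>F. G c \<le> \<beta>"
  proof (rule ccontr)
    assume "\<not> ?thesis"
    then have "(\<Sum>c\<in>F. \<beta>) < (\<Sum>c\<in>F. G c)"
      using assms by (intro sum_strict_mono) auto
    with assms show False by simp
  qed
  with that show ?thesis by blast
qed

text \<open>Codewords carry a message \<open>m\<close> and a randomization index \<open>l\<close>. The legitimate receiver decodes
  both; the eavesdropper, when told \<open>m\<close>, decodes \<open>l\<close>.\<close>
lemma exists_good_codebook:
  fixes M L :: nat
  assumes M: "0 < M" and L: "0 < L" and q: "0 \<le> q" "q \<le> 1"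
    and p: "\<And>j. 0 \<le> p j \<and> p j \<le> 1" and pe: "\<And>j. 0 \<le> pe j \<and> pe j \<le> 1"
    and pos: "0 < N" "0 < B" "0 < \<delta>"
  defines "I \<equiv> {..<M} \<times> {..<L}"
  defines "\<theta> \<equiv> threshold q p N B \<delta>" and "\<theta>e \<equiv> threshold q pe N B \<delta>"
  defines "\<beta> \<equiv> (spread q p + spread q pe) / (real B * \<delta>\<^sup>2) +
      (real (M * L) - 1) * 2 powr (\<theta> - real (N * B)) + (real L - 1) * 2 powr (\<theta>e - real (N * B))"
  obtains c where "c \<in> I \<rightarrow>\<^sub>E words (N * B)"
    and "(\<Sum>i\<in>I. \<Sum>s\<in>states B. state_prob q s * (\<Sum>y\<in>words (N * B). bf_bsc p N s (c i) y *
            of_bool (typical_decode (bf_bsc p N s) \<theta> I c y \<noteq> i))) \<le> real (M * L) * \<beta>"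
    and "(\<Sum>i\<in>I. \<Sum>s\<in>states B. state_prob q s * (\<Sum>y\<in>words (N * B). bf_bsc pe N s (c i) y *
            of_bool (typical_decode (bf_bsc pe N s) \<theta>e ({fst i} \<times> {..<L}) c y \<noteq> i))) \<le> real (M * L) * \<beta>"
proof -
  let ?F = "I \<rightarrow>\<^sub>E words (N * B)"
  let ?G = "\<lambda>c i. \<Sum>s\<in>states B. state_prob q s * (\<Sum>y\<in>words (N * B). bf_bsc p N s (c i) y *
            of_bool (typical_decode (bf_bsc p N s) \<theta> I c y \<noteq> i))"
  let ?H = "\<lambda>c i. \<Sum>s\<in>states B. state_prob q s * (\<Sum>y\<in>words (N * B). bf_bsc pe N s (c i) y *
            of_bool (typical_decode (bf_bsc pe N s) \<theta>e ({fst i} \<times> {..<L}) c y \<noteq> i))"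
  have fin: "finite I" and cardI: "card I = M * L" by (simp_all add: I_def)
  have "words (N * B) \<noteq> {}"
    using card_words[of "N * B"] by (auto simp del: card_0_eq)
  then have F: "finite ?F" "?F \<noteq> {}"
    using fin by (auto intro!: finite_PiE simp: PiE_eq_empty_iff)
  \<comment> \<open>One codebook has to serve both decoders, so their errors are averaged jointly;
    nonnegativity then gives each its own bound.\<close>
  have "(\<Sum>c\<in>?F. \<Sum>i\<in>I. ?G c i + ?H c i) = (\<Sum>i\<in>I. (\<Sum>c\<in>?F. ?G c i) + (\<Sum>c\<in>?F. ?H c i))"
    by (subst sum.swap) (simp only: sum.distrib)
  also have "\<dots> \<le> (\<Sum>i\<in>I. real (card ?F) * \<beta>)"
  proof (rule sum_mono)
    fix i assume i: "i \<in> I"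
    have "(\<Sum>c\<in>?F. ?G c i) \<le> real (card ?F) *
        (spread q p / (real B * \<delta>\<^sup>2) + (real (M * L) - 1) * 2 powr (\<theta> - real (N * B)))"
      unfolding \<theta>_def cardI[symmetric] using fin i q p pos by (intro sum_codebooks_error_le) auto
    moreover have "(\<Sum>c\<in>?F. ?H c i) \<le> real (card ?F) *
        (spread q pe / (real B * \<delta>\<^sup>2) + (real (card ({fst i} \<times> {..<L})) - 1) * 2 powr (\<theta>e - real (N * B)))"
      unfolding \<theta>e_def using fin i q pe pos by (intro sum_codebooks_error_le) (auto simp: I_def)
    ultimately show "(\<Sum>c\<in>?F. ?G c i) + (\<Sum>c\<in>?F. ?H c i) \<le> real (card ?F) * \<beta>"
      by (simp add: \<beta>_def algebra_simps add_divide_distrib card_cartesian_product)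
  qed
  also have "\<dots> = real (card ?F) * (real (M * L) * \<beta>)"
    by (simp add: cardI)
  finally obtain c where c: "c \<in> ?F" "(\<Sum>i\<in>I. ?G c i + ?H c i) \<le> real (M * L) * \<beta>"
    by (rule exists_le_average[OF F])
  have "0 \<le> (\<Sum>i\<in>I. ?G c i)" "0 \<le> (\<Sum>i\<in>I. ?H c i)"
    using q p pe by (auto intro!: sum_nonneg mult_nonneg_nonneg state_prob_nonneg bf_bsc_nonneg)
  with c show ?thesis by (intro that) (auto simp: sum.distrib)
qed

section \<open>Achievability\<close>

lemma sum_pairs: "(\<Sum>m\<in>A. \<Sum>l\<in>B. g (m, l)) = (\<Sum>i\<in>A \<times> B. g i)"
  by (simp add: sum.cartesian_product)

section \<open>Maximal entropy and nonnegativity\<close>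

lemma neg_sum_xlog_le:
  assumes "finite Y" "Y \<noteq> {}" "\<And>y. y \<in> Y \<Longrightarrow> 0 \<le> P y" "(\<Sum>y\<in>Y. P y) = 1"
  shows "- (\<Sum>y\<in>Y. xlog (P y)) \<le> log 2 (card Y)"
proof -
  have card: "0 < real (card Y)" using assms by (simp add: card_gt_0_iff)
  have "0 \<le> (\<Sum>y\<in>Y. P y * log 2 (P y / (1 / card Y)))"
    using assms card by (intro gibbs) auto
  also have "\<dots> = (\<Sum>y\<in>Y. xlog (P y) + P y * log 2 (card Y))"
  proof (intro sum.cong refl)
    fix y assume "y \<in> Y"
    then show "P y * log 2 (P y / (1 / card Y)) = xlog (P y) + P y * log 2 (card Y)"
      using assms(3)[of y] card
      by (cases "P y = 0") (auto simp: xlog_def log_mult distrib_left)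
  qed
  also have "\<dots> = (\<Sum>y\<in>Y. xlog (P y)) + log 2 (card Y)"
    using assms(4) by (simp add: sum.distrib flip: sum_distrib_right)
  finally show ?thesis by simp
qed

text \<open>Gibbs' inequality against the product of the uniform law and the marginal. It supplies
  the lower half of the squeeze that sends the leakage to 0.\<close>

lemma mutual_info_nonneg:
  assumes "0 < M" "finite Y" "\<And>m y. m < M \<Longrightarrow> y \<in> Y \<Longrightarrow> 0 \<le> P m y" "(\<Sum>m<M. \<Sum>y\<in>Y. P m y) = 1"
  shows "0 \<le> mutual_info M Y P"
proof -
  let ?Q = "\<lambda>y. (1 / real M) * (\<Sum>m<M. P m y)"
  have "0 \<le> (\<Sum>(m, y)\<in>{..<M} \<times> Y. P m y * log 2 (P m y / ?Q y))"
    unfolding split_def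
  proof (rule gibbs)
    have "(\<Sum>z\<in>{..<M} \<times> Y. ?Q (snd z)) = (\<Sum>m<M. \<Sum>y\<in>Y. ?Q y)"
      using sum.cartesian_product[of "\<lambda>m. ?Q" Y "{..<M}"] by (simp only: split_def)
    also have "\<dots> = (\<Sum>y\<in>Y. \<Sum>m<M. P m y)"
      using assms(1) by (simp flip: sum_divide_distrib)
    also have "\<dots> = (\<Sum>z\<in>{..<M} \<times> Y. P (fst z) (snd z))"
      by (subst sum.swap) (simp add: sum.cartesian_product split_def)
    finally show "(\<Sum>z\<in>{..<M} \<times> Y. ?Q (snd z)) \<le> (\<Sum>z\<in>{..<M} \<times> Y. P (fst z) (snd z))" by simp
  next
    fix z assume z: "z \<in> {..<M} \<times> Y"
    then show "0 \<le> P (fst z) (snd z)" "0 \<le> ?Q (snd z)"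
      using assms by (auto intro!: sum_nonneg divide_nonneg_nonneg)
    show "P (fst z) (snd z) = 0" if "?Q (snd z) = 0"
    proof (rule sum_nonneg_0[of "{..<M}" "\<lambda>m. P m (snd z)"])
      show "(\<Sum>m<M. P m (snd z)) = 0" using that assms(1) by simp
    qed (use z assms in auto)
  qed
  then show ?thesis
    using mutual_info_altdef[OF assms(1,3,4)] by (simp add: sum.cartesian_product)
qed

lemma leakage_nonneg:
  assumes enc: "valid_encoder N B M enc" and M: "0 < M" and p: "\<And>j. 0 \<le> p j \<and> p j \<le> 1"
    and q: "0 \<le> q" "q \<le> 1"
  shows "0 \<le> leakage q p N B M enc"
  unfolding leakage_altdef[OF enc M p]
  using joint_mz_nonneg[OF enc p] sum_joint_mz[OF enc M] M
  by (intro sum_nonneg mult_nonneg_nonneg state_prob_nonneg q mutual_info_nonneg) auto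

lemma err_prob_nonneg:
  assumes enc: "valid_encoder N B M enc" and p: "\<And>j. 0 \<le> p j \<and> p j \<le> 1" and q: "0 \<le> q" "q \<le> 1"
  shows "0 \<le> err_prob q p N B M enc dec"
  unfolding err_prob_altdef using joint_mz_nonneg[OF enc p]
  by (intro sum_nonneg mult_nonneg_nonneg state_prob_nonneg q) auto

text \<open>Indices rather than distinct codewords are counted, because a random codebook may repeat
  words.\<close>

definition codebook_encoder :: "nat \<Rightarrow> (nat \<times> nat \<Rightarrow> bool list) \<Rightarrow> nat \<Rightarrow> bool list \<Rightarrow> real" where
  "codebook_encoder L c m x = (\<Sum>l<L. of_bool (c (m, l) = x)) / real L"

lemma sum_codebook_encoder:
  assumes "\<And>l. l < L \<Longrightarrow> c (m, l) \<in> words n"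
  shows "(\<Sum>x\<in>words n. codebook_encoder L c m x * g x) = (\<Sum>l<L. g (c (m, l))) / real L"
proof -
  have "(\<Sum>x\<in>words n. codebook_encoder L c m x * g x) =
        (\<Sum>x\<in>words n. \<Sum>l<L. of_bool (c (m, l) = x) * g x) / real L"
    by (simp add: codebook_encoder_def sum_divide_distrib sum_distrib_right)
  also have "(\<Sum>x\<in>words n. \<Sum>l<L. of_bool (c (m, l) = x) * g x) =
        (\<Sum>l<L. \<Sum>x\<in>words n. if c (m, l) = x then g x else 0)"
    by (subst sum.swap) (auto intro!: sum.cong)
  also have "\<dots> = (\<Sum>l<L. g (c (m, l)))"
    using assms by (intro sum.cong refl) (simp add: sum.delta')
  finally show ?thesis .
qed

lemma valid_codebook_encoder:
  assumes c: "c \<in> {..<M} \<times> {..<L} \<rightarrow>\<^sub>E words (N * B)" and L: "0 < L"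
  shows "valid_encoder N B M (codebook_encoder L c)"
  unfolding valid_encoder_def
proof (intro allI impI conjI)
  fix m x assume m: "m < M"
  have cw: "c (m, l) \<in> words (N * B)" if "l < L" for l using c m that by (auto simp: PiE_iff)
  show "0 \<le> codebook_encoder L c m x"
    by (simp add: codebook_encoder_def sum_nonneg)
  show "codebook_encoder L c m x = 0" if "x \<notin> words (N * B)"
    using cw that by (auto simp: codebook_encoder_def intro!: sum.neutral)
  show "(\<Sum>x\<in>words (N * B). codebook_encoder L c m x) = 1"
    using sum_codebook_encoder[where g = "\<lambda>_. 1" and c = c and m = m and L = L, OF cw] L by simp
qed

lemma joint_mz_codebook:
  assumes c: "c \<in> {..<M} \<times> {..<L} \<rightarrow>\<^sub>E words (N * B)" and m: "m < M"
  shows "joint_mz p N B M (codebook_encoder L c) s m z =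
         (\<Sum>l<L. bf_bsc p N s (c (m, l)) z / real (M * L))"
proof -
  have "c (m, l) \<in> words (N * B)" if "l < L" for l using c m that by (auto simp: PiE_iff)
  then show ?thesis
    by (simp add: joint_mz_def sum_codebook_encoder sum_divide_distrib mult.commute)
qed

text \<open>I(M;Z) = I(M,L;Z) - I(L;Z|M). The first term is at most \<open>N * B\<close> bits minus
  the noise entropy; the second is \<open>log 2 L\<close> minus the entropy of the index given
  \<open>(m, z)\<close>, which Fano's inequality bounds.\<close>

lemma mutual_info_codebook_le:
  assumes c: "c \<in> {..<M} \<times> {..<L} \<rightarrow>\<^sub>E words (N * B)" and M: "0 < M" and L: "0 < L"
    and p: "\<And>j. 0 \<le> p j \<and> p j \<le> 1"
  shows "mutual_info M (words (N * B)) (joint_mz p N B M (codebook_encoder L c) s) \<le>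
         real (N * B) - (\<Sum>i<N * B. bin_entropy (p (s ! (i div N)))) - log 2 L + 1 +
         log 2 L * (\<Sum>i\<in>{..<M} \<times> {..<L}. \<Sum>z\<in>words (N * B).
           bf_bsc p N s (c i) z / real (M * L) * of_bool (d (fst i) z \<noteq> snd i))"
proof -
  let ?X = "words (N * B)"
  let ?J = "joint_mz p N B M (codebook_encoder L c) s"
  let ?W = "\<lambda>m l z. bf_bsc p N s (c (m, l)) z"
  \<comment> \<open>Arranged for \<open>fano\<close> with \<open>l\<close> as the hidden index and
    the pair \<open>(m, z)\<close> as the observation: the fictitious decoder sees the
    message.\<close>
  let ?P = "\<lambda>l mz. ?W (fst mz) l (snd mz) / real (M * L)"
  let ?h = "\<Sum>i<N * B. bin_entropy (p (s ! (i div N)))"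
  note enc = valid_codebook_encoder[OF c L]
  have cw: "c (m, l) \<in> ?X" if "m < M" "l < L" for m l using c that by (auto simp: PiE_iff)
  have card_pos: "0 < real (M * L)" using M L by simp
  have W: "0 \<le> ?W m l z" for m l z using p by (rule bf_bsc_nonneg)
  have total: "(\<Sum>l<L. \<Sum>mz\<in>{..<M} \<times> ?X. ?P l mz) = 1"
  proof -
    have "(\<Sum>l<L. \<Sum>mz\<in>{..<M} \<times> ?X. ?P l mz) = (\<Sum>l<L. \<Sum>m<M. \<Sum>z\<in>?X. ?W m l z / real (M * L))"
      by (simp add: sum.cartesian_product split_def)
    also have "\<dots> = (\<Sum>l<L. \<Sum>m<M. 1 / real (M * L))"
      by (intro sum.cong refl) (simp add: sum_bf_bsc cw flip: sum_divide_distrib)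
    finally show ?thesis using M L by simp
  qed
  have xlog_scale: "xlog (w / real (M * L)) = xlog w / real (M * L) - w * (log 2 (M * L) / real (M * L))"
    if "0 \<le> w" for w
    using that card_pos by (cases "w = 0") (auto simp: xlog_def log_divide algebra_simps diff_divide_distrib)
  have xlog_total: "(\<Sum>l<L. \<Sum>mz\<in>{..<M} \<times> ?X. xlog (?P l mz)) = - ?h - log 2 (M * L)"
  proof -
    have "(\<Sum>l<L. \<Sum>mz\<in>{..<M} \<times> ?X. xlog (?P l mz)) =
          (\<Sum>l<L. \<Sum>m<M. \<Sum>z\<in>?X. xlog (?W m l z / real (M * L)))"
      by (simp add: sum.cartesian_product split_def)
    also have "\<dots> = (\<Sum>l<L. \<Sum>m<M. (- ?h - log 2 (M * L)) / real (M * L))"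
    proof (intro sum.cong refl)
      fix l m assume "l \<in> {..<L}" "m \<in> {..<M}"
      then have x: "c (m, l) \<in> ?X" using cw by simp
      have "(\<Sum>z\<in>?X. xlog (?W m l z / real (M * L))) =
            (\<Sum>z\<in>?X. xlog (?W m l z)) / real (M * L) - (\<Sum>z\<in>?X. ?W m l z) * (log 2 (M * L) / real (M * L))"
        by (simp only: xlog_scale[OF W] sum_subtractf sum_divide_distrib sum_distrib_right)
      also have "\<dots> = (- ?h - log 2 (M * L)) / real (M * L)"
        by (simp only: sum_xlog_bf_bsc[OF x p] sum_bf_bsc[OF x] diff_divide_distrib mult_1)
      finally show "(\<Sum>z\<in>?X. xlog (?W m l z / real (M * L))) = (- ?h - log 2 (M * L)) / real (M * L)" .
    qed
    also have "\<dots> = - ?h - log 2 (M * L)" using M L by simp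
    finally show ?thesis .
  qed
  have "(\<Sum>mz\<in>{..<M} \<times> ?X. xlog (\<Sum>l<L. ?P l mz)) - (\<Sum>l<L. \<Sum>mz\<in>{..<M} \<times> ?X. xlog (?P l mz)) \<le>
        (\<Sum>l<L. \<Sum>mz\<in>{..<M} \<times> ?X. ?P l mz) + log 2 (card {..<L}) *
          (\<Sum>l<L. \<Sum>mz\<in>{..<M} \<times> ?X. ?P l mz * of_bool (d (fst mz) (snd mz) \<noteq> l))"
    using W L by (intro fano[where d = "\<lambda>mz. d (fst mz) (snd mz)"]) auto
  moreover have "(\<Sum>mz\<in>{..<M} \<times> ?X. xlog (\<Sum>l<L. ?P l mz)) = (\<Sum>m<M. \<Sum>z\<in>?X. xlog (?J m z))"
    using joint_mz_codebook[OF c] by (simp add: sum.cartesian_product split_def)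
  moreover have "(\<Sum>l<L. \<Sum>mz\<in>{..<M} \<times> ?X. ?P l mz * of_bool (d (fst mz) (snd mz) \<noteq> l)) =
      (\<Sum>i\<in>{..<M} \<times> {..<L}. \<Sum>z\<in>?X. bf_bsc p N s (c i) z / real (M * L) * of_bool (d (fst i) z \<noteq> snd i))"
  proof -
    have "(\<Sum>l<L. \<Sum>mz\<in>{..<M} \<times> ?X. ?P l mz * of_bool (d (fst mz) (snd mz) \<noteq> l)) =
          (\<Sum>l<L. \<Sum>m<M. \<Sum>z\<in>?X. ?W m l z / real (M * L) * of_bool (d m z \<noteq> l))"
      by (simp add: sum.cartesian_product split_def)
    also have "\<dots> = (\<Sum>m<M. \<Sum>l<L. \<Sum>z\<in>?X. ?W m l z / real (M * L) * of_bool (d m z \<noteq> l))"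
      by (rule sum.swap)
    finally show ?thesis
      using sum_pairs[of "\<lambda>i. \<Sum>z\<in>?X. bf_bsc p N s (c i) z / real (M * L) * of_bool (d (fst i) z \<noteq> snd i)"
          "{..<L}" "{..<M}"] by simp
  qed
  moreover have "- (\<Sum>z\<in>?X. xlog (\<Sum>m<M. ?J m z)) \<le> log 2 (card ?X)"
  proof (rule neg_sum_xlog_le)
    show "?X \<noteq> {}" using cw[OF M L] by auto
    show "(\<Sum>z\<in>?X. \<Sum>m<M. ?J m z) = 1"
      by (subst sum.swap) (rule sum_joint_mz[OF enc M])
  qed (auto intro!: sum_nonneg joint_mz_nonneg[OF enc p])
  moreover have "log 2 (card ?X) = real (N * B)"
    by (simp add: card_words log_nat_power)
  moreover have "log 2 (M * L) = log 2 M + log 2 L"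
    using M L by (simp add: log_mult)
  ultimately show ?thesis
    unfolding mutual_info_def xlog_total total by simp
qed

lemma exists_good_code:
  fixes M L :: nat
  assumes M: "0 < M" and L: "0 < L" and q: "0 \<le> q" "q \<le> 1"
    and p: "\<And>j. 0 \<le> p j \<and> p j \<le> 1" and pe: "\<And>j. 0 \<le> pe j \<and> pe j \<le> 1"
    and pos: "0 < N" "0 < B" "0 < \<delta>"
  defines "\<beta> \<equiv> (spread q p + spread q pe) / (real B * \<delta>\<^sup>2) +
      (real (M * L) - 1) * 2 powr (threshold q p N B \<delta> - real (N * B)) +
      (real L - 1) * 2 powr (threshold q pe N B \<delta> - real (N * B))"
  obtains enc dec where "valid_encoder N B M enc" "err_prob q p N B M enc dec \<le> \<beta>"
    "leakage q pe N B M enc \<le> real (N * B) * (1 - mean_entropy q pe) - log 2 L + 1 + log 2 L * \<beta>"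
proof -
  define \<theta> where "\<theta> = threshold q p N B \<delta>"
  define \<theta>e where "\<theta>e = threshold q pe N B \<delta>"
  let ?I = "{..<M} \<times> {..<L}" and ?X = "words (N * B)"
  have card_pos: "0 < real (M * L)" using M L by simp
  obtain c where c: "c \<in> ?I \<rightarrow>\<^sub>E ?X"
    and err: "(\<Sum>i\<in>?I. \<Sum>s\<in>states B. state_prob q s * (\<Sum>y\<in>?X. bf_bsc p N s (c i) y *
            of_bool (typical_decode (bf_bsc p N s) \<theta> ?I c y \<noteq> i))) \<le> real (M * L) * \<beta>"
    and err_e: "(\<Sum>i\<in>?I. \<Sum>s\<in>states B. state_prob q s * (\<Sum>y\<in>?X. bf_bsc pe N s (c i) y *
            of_bool (typical_decode (bf_bsc pe N s) \<theta>e ({fst i} \<times> {..<L}) c y \<noteq> i))) \<le> real (M * L) * \<beta>"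
    unfolding \<beta>_def \<theta>_def \<theta>e_def
    by (rule exists_good_codebook[where p = p and pe = pe, OF M L q p pe pos])
  \<comment> \<open>Only the message part is kept; a wrong message implies a wrong pair, so the
    pair's error bound applies.\<close>
  define dec where "dec y s = fst (typical_decode (bf_bsc p N s) \<theta> ?I c y)" for y s
  define d where "d s m z = snd (typical_decode (bf_bsc pe N s) \<theta>e ({m} \<times> {..<L}) c z)" for s m z
  let ?enc = "codebook_encoder L c"
  note enc = valid_codebook_encoder[OF c L]
  have scale: "(\<Sum>s\<in>states B. state_prob q s * (\<Sum>i\<in>?I. \<Sum>y\<in>?X. w s i y / real (M * L) * e s i y)) =
      (\<Sum>i\<in>?I. \<Sum>s\<in>states B. state_prob q s * (\<Sum>y\<in>?X. w s i y * e s i y)) / real (M * L)"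
    for w e :: "nat list \<Rightarrow> nat \<times> nat \<Rightarrow> bool list \<Rightarrow> real"
    by (subst sum.swap) (simp add: sum_distrib_left sum_divide_distrib)
  have "err_prob q p N B M ?enc dec = (\<Sum>s\<in>states B. state_prob q s *
      (\<Sum>i\<in>?I. \<Sum>y\<in>?X. bf_bsc p N s (c i) y / real (M * L) * of_bool (dec y s \<noteq> fst i)))"
    unfolding err_prob_altdef
  proof (intro sum.cong refl arg_cong2[where f = times])
    fix s
    have "(\<Sum>m<M. \<Sum>y\<in>?X. joint_mz p N B M ?enc s m y * of_bool (dec y s \<noteq> m)) =
          (\<Sum>m<M. \<Sum>y\<in>?X. \<Sum>l<L. bf_bsc p N s (c (m, l)) y / real (M * L) * of_bool (dec y s \<noteq> m))"
      by (intro sum.cong refl, subst joint_mz_codebook[OF c]) (simp, rule sum_distrib_right)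
    also have "\<dots> = (\<Sum>m<M. \<Sum>l<L. \<Sum>y\<in>?X. bf_bsc p N s (c (m, l)) y / real (M * L) * of_bool (dec y s \<noteq> m))"
      by (intro sum.cong refl sum.swap)
    finally show "(\<Sum>m<M. \<Sum>y\<in>?X. joint_mz p N B M ?enc s m y * of_bool (dec y s \<noteq> m)) =
        (\<Sum>i\<in>?I. \<Sum>y\<in>?X. bf_bsc p N s (c i) y / real (M * L) * of_bool (dec y s \<noteq> fst i))"
      using sum_pairs[of "\<lambda>i. \<Sum>y\<in>?X. bf_bsc p N s (c i) y / real (M * L) * of_bool (dec y s \<noteq> fst i)"
          "{..<L}" "{..<M}"] by simp
  qed
  also have "\<dots> \<le> (\<Sum>s\<in>states B. state_prob q s *
      (\<Sum>i\<in>?I. \<Sum>y\<in>?X. bf_bsc p N s (c i) y / real (M * L) *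
         of_bool (typical_decode (bf_bsc p N s) \<theta> ?I c y \<noteq> i)))"
    using card_pos by (intro sum_mono mult_left_mono state_prob_nonneg q divide_nonneg_nonneg bf_bsc_nonneg p)
       (auto simp: dec_def of_bool_def)
  also have "\<dots> \<le> \<beta>"
    using err card_pos by (simp only: scale) (simp add: divide_le_eq mult.commute)
  finally have err_le: "err_prob q p N B M ?enc dec \<le> \<beta>" .
  let ?Ee = "\<lambda>s. \<Sum>i\<in>?I. \<Sum>z\<in>?X. bf_bsc pe N s (c i) z / real (M * L) * of_bool (d s (fst i) z \<noteq> snd i)"
  have "(\<Sum>s\<in>states B. state_prob q s * ?Ee s) \<le> (\<Sum>s\<in>states B. state_prob q s *
      (\<Sum>i\<in>?I. \<Sum>z\<in>?X. bf_bsc pe N s (c i) z / real (M * L) *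
         of_bool (typical_decode (bf_bsc pe N s) \<theta>e ({fst i} \<times> {..<L}) c z \<noteq> i)))"
    using card_pos by (intro sum_mono mult_left_mono state_prob_nonneg q divide_nonneg_nonneg bf_bsc_nonneg pe)
       (auto simp: d_def of_bool_def)
  also have "\<dots> \<le> \<beta>"
    using err_e card_pos by (simp only: scale) (simp add: divide_le_eq mult.commute)
  finally have Ee: "(\<Sum>s\<in>states B. state_prob q s * ?Ee s) \<le> \<beta>" .
  have linear: "(\<Sum>s\<in>states B. w s * (n - h s - l + 1 + l * e s)) =
      (\<Sum>s\<in>states B. w s) * (n - l + 1) - (\<Sum>s\<in>states B. w s * h s) + l * (\<Sum>s\<in>states B. w s * e s)"
    for w h e :: "nat list \<Rightarrow> real" and n l
    by (simp add: sum_distrib_left sum_distrib_right sum.distrib sum_subtractf algebra_simps)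
  have "leakage q pe N B M ?enc \<le> (\<Sum>s\<in>states B. state_prob q s *
      (real (N * B) - (\<Sum>i<N * B. bin_entropy (pe (s ! (i div N)))) - log 2 L + 1 + log 2 L * ?Ee s))"
    unfolding leakage_altdef[where p = pe, OF enc M pe]
    by (intro sum_mono mult_left_mono state_prob_nonneg q mutual_info_codebook_le c M L pe)
  also have "\<dots> = (\<Sum>s\<in>states B. state_prob q s) * (real (N * B) - log 2 L + 1)
      - (\<Sum>s\<in>states B. state_prob q s * (\<Sum>i<N * B. bin_entropy (pe (s ! (i div N)))))
      + log 2 L * (\<Sum>s\<in>states B. state_prob q s * ?Ee s)"
    by (rule linear)
  also have "\<dots> = real (N * B) * (1 - mean_entropy q pe) - log 2 L + 1
      + log 2 L * (\<Sum>s\<in>states B. state_prob q s * ?Ee s)"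
    unfolding sum_state_prob
      sum_state_prob_mean[where q = q and N = N and B = B and g = "\<lambda>j. bin_entropy (pe j)"]
    by (simp add: mean_entropy_def algebra_simps)
  also have "\<dots> \<le> real (N * B) * (1 - mean_entropy q pe) - log 2 L + 1 + log 2 L * \<beta>"
    using Ee L by (intro add_left_mono mult_left_mono) auto
  finally show ?thesis
    using err_le enc by (intro that)
qed

section \<open>Choice of rates and passage to the limit\<close>

lemma mean_entropy_bounds:
  assumes "0 \<le> q" "q \<le> 1" "\<And>j. 0 \<le> p j \<and> p j \<le> 1/2"
  shows "0 \<le> mean_entropy q p" "mean_entropy q p \<le> 1"
proof -
  show "0 \<le> mean_entropy q p"
    using assms by (simp add: mean_entropy_def bin_entropy_bounds)
  have "mean_entropy q p \<le> q * 1 + (1 - q) * 1"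
    unfolding mean_entropy_def using assms
    by (intro add_mono mult_left_mono bin_entropy_bounds) auto
  then show "mean_entropy q p \<le> 1" by simp
qed

lemma mean_entropy_mono:
  assumes "0 \<le> q" "q \<le> 1" "\<And>j. 0 \<le> p j \<and> p j \<le> pe j \<and> pe j \<le> 1/2"
  shows "mean_entropy q p \<le> mean_entropy q pe"
  unfolding mean_entropy_def using assms
  by (intro add_mono mult_left_mono bin_entropy_mono) auto

text \<open>The exponent may be negative; rounding up keeps the number of indices positive, at the
  price of the \<open>+ 1\<close>.\<close>

lemma ceiling_powr_bounds:
  fixes x :: real
  defines "K \<equiv> nat \<lceil>2 powr x\<rceil>"
  shows "0 < K" "2 powr x \<le> real K" "real K \<le> 2 powr x + 1" "x \<le> log 2 K"
proof -
  show "2 powr x \<le> real K" "real K \<le> 2 powr x + 1"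
    using powr_gt_zero[of 2 x] ceiling_correct[of "2 powr x"] unfolding K_def by linarith+
  then show "0 < K" using powr_gt_zero[of 2 x] by linarith
  then show "x \<le> log 2 K" using \<open>2 powr x \<le> real K\<close> by (simp add: le_log_iff)
qed

lemma exists_code_near_capacity:
  fixes b :: nat and p pe :: "nat \<Rightarrow> real"
  assumes q: "0 \<le> q" "q \<le> 1" and p: "\<And>j. 0 \<le> p j \<and> p j \<le> pe j \<and> pe j \<le> 1/2"
    and pos: "0 < b" "0 < \<delta>"
  defines "\<beta> \<equiv> (spread q p + spread q pe) / (real b * \<delta>\<^sup>2) + 4 * 2 powr - (real (b * b) * \<delta>)"
  shows "\<exists>M enc dec. 1 \<le> M \<and> valid_encoder b b M enc \<and>
           mean_entropy q pe - mean_entropy q p - 2 * \<delta> \<le> log 2 (real M) / real (b * b) \<and>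
           err_prob q p b b M enc dec \<le> \<beta> \<and>
           leakage q pe b b M enc / real (b * b) \<le> 2 * \<delta> + 1 / real (b * b) + 2 * \<beta>"
proof -
  define n where "n = real (b * b)"
  define h where "h = mean_entropy q p"
  define he where "he = mean_entropy q pe"
  \<comment> \<open>The slacks \<open>2 * \<delta>\<close> in \<open>x\<close> and \<open>y\<close>
    exceed the \<open>\<delta>\<close> inside the thresholds, so each of the four collision terms
    ends at or below \<open>2 powr - (n * \<delta>)\<close>; hence the constant 4 in
    \<open>\<beta>\<close>.\<close>
  define x where "x = n * (he - h - 2 * \<delta>)"
  define y where "y = n * (1 - he - 2 * \<delta>)"
  define M where "M = nat \<lceil>2 powr x\<rceil>"
  define L where "L = nat \<lceil>2 powr y\<rceil>"
  have p': "0 \<le> p j \<and> p j \<le> 1" "0 \<le> pe j \<and> pe j \<le> 1" "0 \<le> p j \<and> p j \<le> 1/2" "0 \<le> pe j \<and> pe j \<le> 1/2" for j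
    using p[of j] by auto
  have "1 \<le> b * b" using pos by simp
  then have n: "1 \<le> n" unfolding n_def by linarith
  have h: "0 \<le> h" "h \<le> he" "he \<le> 1"
    unfolding h_def he_def
    using mean_entropy_bounds[OF q p'(3)] mean_entropy_bounds[OF q p'(4)] mean_entropy_mono[OF q p] by auto
  note M = ceiling_powr_bounds[of x, folded M_def]
  note L = ceiling_powr_bounds[of y, folded L_def]
  define \<beta>' where "\<beta>' = (spread q p + spread q pe) / (real b * \<delta>\<^sup>2) +
      (real (M * L) - 1) * 2 powr (threshold q p b b \<delta> - real (b * b)) +
      (real L - 1) * 2 powr (threshold q pe b b \<delta> - real (b * b))"
  obtain enc dec where enc: "valid_encoder b b M enc"
    and err: "err_prob q p b b M enc dec \<le> \<beta>'"
    and leak: "leakage q pe b b M enc \<le> real (b * b) * (1 - mean_entropy q pe) - log 2 L + 1 + log 2 L * \<beta>'"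
    unfolding \<beta>'_def by (rule exists_good_code[where p = p and pe = pe, OF M(1) L(1) q p'(1,2) pos(1) pos])
  have "real M * real L \<le> (2 powr x + 1) * (2 powr y + 1)"
    using M(3) L(3) by (intro mult_mono) auto
  \<comment> \<open>The \<open>- 1\<close> cancels the constant left by the two roundings.
    Multiplied by \<open>2 powr (n * (h + \<delta> - 1))\<close>, that constant would not be small
    when \<open>h\<close> is near 1.\<close>
  then have "real (M * L) - 1 \<le> 2 powr (x + y) + 2 powr x + 2 powr y"
    by (simp add: powr_add algebra_simps)
  then have "(real (M * L) - 1) * 2 powr (n * (h + \<delta> - 1)) \<le>
      (2 powr (x + y) + 2 powr x + 2 powr y) * 2 powr (n * (h + \<delta> - 1))"
    by (rule mult_right_mono) simp
  also have "\<dots> = 2 powr (n * (- 3 * \<delta>)) + 2 powr (n * (he - 1 - \<delta>)) + 2 powr (n * (h - he - \<delta>))"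
    unfolding distrib_right powr_add[symmetric] x_def y_def by (simp add: algebra_simps)
  also have "\<dots> \<le> 2 powr (n * - \<delta>) + 2 powr (n * - \<delta>) + 2 powr (n * - \<delta>)"
    using h n pos by (intro add_mono powr_mono mult_left_mono) auto
  finally have 1: "(real (M * L) - 1) * 2 powr (n * (h + \<delta> - 1)) \<le> 3 * 2 powr - (n * \<delta>)"
    by simp
  have "(real L - 1) * 2 powr (n * (he + \<delta> - 1)) \<le> 2 powr y * 2 powr (n * (he + \<delta> - 1))"
    using L(3) by (intro mult_right_mono) auto
  also have "\<dots> = 2 powr - (n * \<delta>)"
    unfolding powr_add[symmetric] y_def by (simp add: algebra_simps)
  finally have 2: "(real L - 1) * 2 powr (n * (he + \<delta> - 1)) \<le> 2 powr - (n * \<delta>)" .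
  have "threshold q p b b \<delta> - real (b * b) = n * (h + \<delta> - 1)"
    "threshold q pe b b \<delta> - real (b * b) = n * (he + \<delta> - 1)"
    unfolding threshold_def n_def h_def he_def by (simp_all add: algebra_simps)
  with 1 2 have \<beta>: "\<beta>' \<le> \<beta>"
    unfolding \<beta>_def \<beta>'_def n_def by simp
  have \<beta>0: "0 \<le> \<beta>"
    using err_prob_nonneg[where p = p, OF enc p'(1) q, where dec = dec] err \<beta> by linarith
  \<comment> \<open>The error enters the leakage multiplied by \<open>log 2 L\<close>, so a bound
    linear in \<open>n\<close> is wanted; \<open>2 * n\<close> absorbs the rounding.\<close>
  have "y \<le> n * 1" unfolding y_def using n h pos by (intro mult_left_mono) auto
  then have "real L \<le> 2 powr n + 1"
    using L(3) powr_mono[of y n "2 :: real"] by linarith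
  also have "\<dots> \<le> 2 powr n * 2" using n ge_one_powr_ge_zero[of 2 n] by simp
  also have "\<dots> = 2 powr (n + 1)" by (simp add: powr_add)
  finally have "log 2 L \<le> n + 1" using L(1) by (simp add: log_le_iff)
  then have "log 2 L \<le> 2 * n" using n by linarith
  then have "log 2 L * \<beta>' \<le> 2 * n * \<beta>"
    using mult_left_mono[OF \<beta>, of "log 2 L"] mult_right_mono[of "log 2 L" "2 * n" \<beta>] \<beta>0 L(1) by simp
  with leak L(4) have "leakage q pe b b M enc \<le> n * (2 * \<delta>) + 1 + n * (2 * \<beta>)"
    unfolding y_def n_def he_def by (simp add: algebra_simps)
  then have "leakage q pe b b M enc / n \<le> (n * (2 * \<delta>) + 1 + n * (2 * \<beta>)) / n"
    using n by (intro divide_right_mono) auto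
  also have "\<dots> = 2 * \<delta> + 1 / n + 2 * \<beta>" using n by (simp add: field_simps)
  finally have leak': "leakage q pe b b M enc / n \<le> 2 * \<delta> + 1 / n + 2 * \<beta>" .
  have "he - h - 2 * \<delta> \<le> log 2 M / n"
    using M(4) n unfolding x_def by (simp add: field_simps)
  with enc err \<beta> leak' M(1) show ?thesis
    unfolding n_def h_def he_def by (intro exI[of _ M] exI[of _ enc] exI[of _ dec]) auto
qed

lemma capacity_achievable:
  assumes q: "0 \<le> q" "q \<le> 1" and p: "\<And>j. 0 \<le> p j \<and> p j \<le> pe j \<and> pe j \<le> 1/2"
  shows "achievable_csid q p pe (mean_entropy q pe - mean_entropy q p)"
proof -
  let ?C = "mean_entropy q pe - mean_entropy q p"
  let ?S = "spread q p + spread q pe"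
  define b :: "nat \<Rightarrow> nat" where "b k = Suc k" for k
  \<comment> \<open>Any exponent strictly between -1/2 and 0 would serve: \<open>\<delta>\<close>
    must vanish while \<open>b * \<delta>^2\<close>, here the square root of \<open>b\<close>, tends
    to infinity.\<close>
  define \<delta> where "\<delta> k = real (b k) powr (- 1 / 4)" for k
  define \<beta> where "\<beta> k = ?S / (real (b k) * (\<delta> k)\<^sup>2) + 4 * 2 powr - (real (b k * b k) * \<delta> k)" for k
  have p': "0 \<le> p j \<and> p j \<le> 1" "0 \<le> pe j \<and> pe j \<le> 1" for j
    using p[of j] by auto
  have pos: "0 < b k" "0 < \<delta> k" for k by (simp_all add: b_def \<delta>_def)
  have "\<forall>k. \<exists>M enc dec. 1 \<le> M \<and> valid_encoder (b k) (b k) M enc \<and>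
           ?C - 2 * \<delta> k \<le> log 2 (real M) / real (b k * b k) \<and>
           err_prob q p (b k) (b k) M enc dec \<le> \<beta> k \<and>
           leakage q pe (b k) (b k) M enc / real (b k * b k) \<le> 2 * \<delta> k + 1 / real (b k * b k) + 2 * \<beta> k"
    unfolding \<beta>_def using exists_code_near_capacity[where p = p and pe = pe, OF q p pos] by blast
  then obtain M enc dec where code: "\<And>k. 1 \<le> M k \<and> valid_encoder (b k) (b k) (M k) (enc k) \<and>
           ?C - 2 * \<delta> k \<le> log 2 (real (M k)) / real (b k * b k) \<and>
           err_prob q p (b k) (b k) (M k) (enc k) (dec k) \<le> \<beta> k \<and>
           leakage q pe (b k) (b k) (M k) (enc k) / real (b k * b k) \<le> 2 * \<delta> k + 1 / real (b k * b k) + 2 * \<beta> k"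
    by metis
  have \<delta>_lim: "\<delta> \<longlonglongrightarrow> 0" unfolding \<delta>_def b_def by real_asymp
  have n_lim: "(\<lambda>k. 1 / real (b k * b k)) \<longlonglongrightarrow> 0" unfolding b_def by real_asymp
  have "(\<lambda>k. 1 / (real (b k) * (\<delta> k)\<^sup>2)) \<longlonglongrightarrow> 0"
    "(\<lambda>k. 4 * 2 powr - (real (b k * b k) * \<delta> k)) \<longlonglongrightarrow> 0"
    unfolding \<delta>_def b_def by real_asymp+
  then have "(\<lambda>k. ?S * (1 / (real (b k) * (\<delta> k)\<^sup>2)) + 4 * 2 powr - (real (b k * b k) * \<delta> k)) \<longlonglongrightarrow> ?S * 0 + 0"
    by (intro tendsto_intros)
  then have \<beta>_lim: "\<beta> \<longlonglongrightarrow> 0" unfolding \<beta>_def by simp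
  have b_lim: "filterlim b at_top sequentially"
    unfolding b_def by (rule filterlim_Suc)
  show ?thesis
    unfolding achievable_csid_def
  proof (rule exI[of _ b], rule exI[of _ b], rule exI[of _ M], rule exI[of _ enc], rule exI[of _ dec],
      intro conjI allI impI)
    fix \<epsilon> :: real assume "0 < \<epsilon>"
    then have "eventually (\<lambda>k. \<delta> k < \<epsilon> / 2) sequentially"
      using \<delta>_lim by (intro order_tendstoD) auto
    then show "eventually (\<lambda>k. ?C - \<epsilon> \<le> log 2 (real (M k)) / real (b k * b k)) sequentially"
    proof eventually_elim
      case (elim k)
      then show ?case using code[of k] by linarith
    qed
  next
    show "(\<lambda>k. err_prob q p (b k) (b k) (M k) (enc k) (dec k)) \<longlonglongrightarrow> 0"
    proof (rule tendsto_sandwich[OF _ _ tendsto_const \<beta>_lim])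
      show "eventually (\<lambda>k. 0 \<le> err_prob q p (b k) (b k) (M k) (enc k) (dec k)) sequentially"
        using code err_prob_nonneg[where p = p, OF _ p'(1) q] by (intro always_eventually allI) blast
    qed (use code in \<open>intro always_eventually allI, blast\<close>)
  next
    have "(\<lambda>k. 2 * \<delta> k + 1 / real (b k * b k) + 2 * \<beta> k) \<longlonglongrightarrow> 2 * 0 + 0 + 2 * 0"
      by (intro tendsto_intros \<delta>_lim n_lim \<beta>_lim)
    then have bound: "(\<lambda>k. 2 * \<delta> k + 1 / real (b k * b k) + 2 * \<beta> k) \<longlonglongrightarrow> 0" by simp
    show "(\<lambda>k. leakage q pe (b k) (b k) (M k) (enc k) / real (b k * b k)) \<longlonglongrightarrow> 0"
    proof (rule tendsto_sandwich[OF _ _ tendsto_const bound])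
      show "eventually (\<lambda>k. 0 \<le> leakage q pe (b k) (b k) (M k) (enc k) / real (b k * b k)) sequentially"
        using code leakage_nonneg[where p = pe, OF _ _ p'(2) q]
        by (intro always_eventually allI divide_nonneg_nonneg) (auto simp: Suc_le_eq)
    qed (use code in \<open>intro always_eventually allI, blast\<close>)
  qed (use code pos b_lim in auto)
qed

theorem theorem2:
  fixes q1 q2 p1 p2 ps1 ps2 :: real
  assumes "0 \<le> q1" "q1 \<le> 1" "q2 = 1 - q1"
    and "0 \<le> p1" "p1 \<le> p2" "p2 \<le> 1/2"
    and "0 \<le> ps1" "ps1 \<le> ps2" "ps2 \<le> 1/2"
    and "p1 \<le> ps1" "p2 \<le> ps2"
  shows "cap_csid q1 p1 p2 ps1 ps2 =
           q1 * (bin_entropy ps1 - bin_entropy p1) + q2 * (bin_entropy ps2 - bin_entropy p2)"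
proof -
  let ?p = "\<lambda>j::nat. if j = 1 then p1 else p2"
  let ?pe = "\<lambda>j::nat. if j = 1 then ps1 else ps2"
  let ?C = "q1 * (bin_entropy ps1 - bin_entropy p1) + q2 * (bin_entropy ps2 - bin_entropy p2)"
  have p: "0 \<le> ?p j \<and> ?p j \<le> ?pe j \<and> ?pe j \<le> 1/2" for j
    using assms by auto
  have "mean_entropy q1 ?pe - mean_entropy q1 ?p = ?C"
    by (simp add: mean_entropy_def assms(3) algebra_simps)
  then have "achievable_csid q1 ?p ?pe ?C"
    using capacity_achievable[where p = ?p and pe = ?pe, OF assms(1,2) p] by simp
  moreover have "R \<le> ?C" if "achievable_csid q1 ?p ?pe R" for R
    using converse[where p = ?p and pe = ?pe, OF that p assms(1,2)] assms(3) by simp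
  ultimately show ?thesis
    \<comment> \<open>The supremum is attained: achievability asks for rates
      \<open>R - \<epsilon>\<close> only, so the capacity itself belongs to the set.\<close>
    unfolding cap_csid_def by (intro cSup_eq_maximum) auto
qed

end
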